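(* The resonance index $\operatorname{ind}_{res}(\lambda;H,V)$ does not depend on the choice of the rigging operator $F$, as long as $\lambda$ is essentially regular for the pair $(\mathcal A,F)$, where $\mathcal A=\{H+rV:r\in\mathbb R\}$ and $V$ is a regularizing direction for an operator $H$ which is resonant at $\lambda$. That is, if $F_1:\mathcal H\to\mathcal K_1$ and $F_2:\mathcal H\to\mathcal K_2$ are two admissible rigging operators for $\mathcal A$, if $\lambda$ is essentially regular for both $(\mathcal A,F_1)$ and $(\mathcal A,F_2)$, and if with respect to each of them $H$ is resonant at $\lambda$ and $V$ is a regularizing direction for $H$ at $\lambda$, then the resonance indices $\operatorname{ind}_{res}(\lambda;H,V)$ computed using $F_1$ and using $F_2$ are equal.
   Context: $\mathcal H$ is a complex separable Hilbert space, $H$ and $V$ are self-adjoint operators on $\mathcal H$, $\mathcal A=\{H+rV:r\in\mathbb R\}$ consists of self-adjoint operators with a common dense domain $\mathcal D\subset\operatorname{dom}(V)$, and $V$ is relatively compact with respect to each operator of $\mathcal A$. An operator $F:\mathcal H\to\mathcal K$ ($\mathcal K$ a complex separable Hilbert space) is an admissible rigging operator for $\mathcal A$ if: $F$ is closed and densely defined with trivial kernel and co-kernel; $\mathcal D\subset\operatorname{dom}(F)$; $V=F^*JF$ for a bounded self-adjoint operator $J$ on $\mathcal K$; for non-real $z$ and $G\in\mathcal A$ the operator $T_z(G):=F(G-z)^{-1}F^*$ (densely defined on $\operatorname{dom}F^*$) extends to a compact operator on $\mathcal K$, also denoted $T_z(G)$; and for each $G\in\mathcal A$ the set $\Lambda(G,F)$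 of real $\lambda$ for which the norm limit $T_{\lambda+i0}(G)=\lim_{y\to0^+}T_{\lambda+iy}(G)$ exists has full Lebesgue measure. A real $\lambda$ is essentially regular for $(\mathcal A,F)$ if $\lambda\in\Lambda(G,F)$ for some $G\in\mathcal A$. $G\in\mathcal A$ is regular at $\lambda$ if $\lambda\in\Lambda(G,F)$ and resonant at $\lambda$ otherwise; $V$ is a regularizing direction for $H$ at $\lambda$ if $H+rV$ is regular at $\lambda$ for some real $r$. Resonance index. For $z$ non-real, $A_z(s)=T_z(H+sV)J$ extends meromorphically in $s$ to $\mathbb C$; similarly for $z=\lambda+i0$, where the real poles are the real $s$ with $H+sV$ resonant at $\lambda$; here $s=0$ is such a pole. When $\lambda+i0$ is replaced by $\lambda+iy$ with small $y>0$, the pole $0$ of $A_{\lambda+i0}(s)$ splits into poles of $A_{\lambda+iy}(s)$ converging to $0$ as $y\to0^+$, none of which is real; a pole $r$ is counted with its algebraic multiplicity, i.e. the algebraic multiplicity of the eigenvalue $(s-r)^{-1}$ of $A_{\lambda+iy}(s)$ (independent of real $s$). If $N_+$ (respectively $N_-$) of them lie in the open upper (respectively lower) half-plane, then $\operatorname{ind}_{res}(\lambda;H,V)=N_+-N_-$. *)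

theory Defs
  imports "HOL-Analysis.Analysis"
begin

section \<open>Complex Hilbert spaces\<close>

class complex_normed_vector = real_normed_vector +
  fixes scaleC :: "complex \<Rightarrow> 'a \<Rightarrow> 'a"  (infixr \<open>*\<^sub>C\<close> 75)
  assumes scaleC_add_right: "c *\<^sub>C (x + y) = c *\<^sub>C x + c *\<^sub>C y"
    and scaleC_add_left: "(c + d) *\<^sub>C x = c *\<^sub>C x + d *\<^sub>C x"
    and scaleC_scaleC: "c *\<^sub>C d *\<^sub>C x = (c * d) *\<^sub>C x"
    and scaleC_of_real: "complex_of_real r *\<^sub>C x = r *\<^sub>R x"
    and norm_scaleC: "norm (c *\<^sub>C x) = cmod c * norm x"

lemma scaleC_one: "1 *\<^sub>C x = (x :: 'a :: complex_normed_vector)"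
  using scaleC_of_real[of 1 x] by simp

interpretation complex_vector: vector_space "scaleC :: complex \<Rightarrow> 'a \<Rightarrow> 'a :: complex_normed_vector"
  by unfold_locales (simp_all add: scaleC_add_right scaleC_add_left scaleC_scaleC scaleC_one)

text \<open>The norm comes from \<open>cinner\<close> through its real part, since
  \<open>norm x = sqrt (inner x x)\<close> in the class \<open>real_inner\<close>.\<close>

class complex_hilbert_space = complex_normed_vector + real_inner + complete_space +
  fixes cinner :: "'a \<Rightarrow> 'a \<Rightarrow> complex"
  assumes cinner_commute: "cinner x y = cnj (cinner y x)"
    and cinner_add_left: "cinner (x + y) z = cinner x z + cinner y z"
    and cinner_scaleC_left: "cinner (c *\<^sub>C x) y = c * cinner x y"
    and Re_cinner: "Re (cinner x y) = inner x y"

text \<open>A real-linear bounded operator into a complex space can be multiplied by complex scalars;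
  the complex-linear operators form a complex subspace.\<close>

instantiation blinfun :: (real_normed_vector, complex_normed_vector) complex_normed_vector
begin

definition scaleC_blinfun :: "complex \<Rightarrow> ('a \<Rightarrow>\<^sub>L 'b) \<Rightarrow> ('a \<Rightarrow>\<^sub>L 'b)" where
  "scaleC_blinfun c L = Blinfun (\<lambda>x. c *\<^sub>C L x)"

lemma blinfun_apply_scaleC: "blinfun_apply (c *\<^sub>C L) x = c *\<^sub>C L x"
proof -
  have "bounded_linear (\<lambda>x. c *\<^sub>C L x)"
  proof (rule bounded_linear_intro[where K = "cmod c * norm L"])
    show "c *\<^sub>C L (x + y) = c *\<^sub>C L x + c *\<^sub>C L y" for x y
      by (simp add: blinfun.add_right scaleC_add_right)
    show "c *\<^sub>C L (r *\<^sub>R x) = r *\<^sub>R c *\<^sub>C L x" for r x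
      by (simp add: blinfun.scaleR_right scaleC_scaleC mult.commute flip: scaleC_of_real)
    show "norm (c *\<^sub>C L x) \<le> norm x * (cmod c * norm L)" for x
      using mult_left_mono[OF norm_blinfun[of L x], of "cmod c"]
      by (simp add: norm_scaleC mult_ac)
  qed
  then show ?thesis
    by (simp add: scaleC_blinfun_def bounded_linear_Blinfun_apply)
qed

instance
proof
  fix c d :: complex and r :: real and L M :: "'a \<Rightarrow>\<^sub>L 'b"
  show "c *\<^sub>C (L + M) = c *\<^sub>C L + c *\<^sub>C M"
    by (rule blinfun_eqI) (simp add: blinfun_apply_scaleC blinfun.add_left scaleC_add_right)
  show "(c + d) *\<^sub>C L = c *\<^sub>C L + d *\<^sub>C L"
    by (rule blinfun_eqI) (simp add: blinfun_apply_scaleC blinfun.add_left scaleC_add_left)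
  show "c *\<^sub>C d *\<^sub>C L = (c * d) *\<^sub>C L"
    by (rule blinfun_eqI) (simp add: blinfun_apply_scaleC scaleC_scaleC)
  show "complex_of_real r *\<^sub>C L = r *\<^sub>R L"
    by (rule blinfun_eqI) (simp add: blinfun_apply_scaleC scaleC_of_real blinfun.scaleR_left)
  have le: "norm (e *\<^sub>C N) \<le> cmod e * norm N" for e and N :: "'a \<Rightarrow>\<^sub>L 'b"
  proof (rule norm_blinfun_bound)
    show "norm (blinfun_apply (e *\<^sub>C N) x) \<le> cmod e * norm N * norm x" for x
      using mult_left_mono[OF norm_blinfun[of N x], of "cmod e"]
      by (simp add: blinfun_apply_scaleC norm_scaleC mult_ac)
  qed simp
  show "norm (c *\<^sub>C L) = cmod c * norm L"
  proof (cases "c = 0")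
    case True
    then show ?thesis using le[of c L] by simp
  next
    case False
    have "inverse c *\<^sub>C c *\<^sub>C L = L"
      by (rule blinfun_eqI) (simp add: blinfun_apply_scaleC scaleC_scaleC scaleC_one False)
    then have "norm L \<le> inverse (cmod c) * norm (c *\<^sub>C L)"
      using le[of "inverse c" "c *\<^sub>C L"] by (simp add: norm_inverse)
    then have "cmod c * norm L \<le> norm (c *\<^sub>C L)"
      using False by (simp add: field_simps)
    with le[of c L] show ?thesis by simp
  qed
qed

end

section \<open>Unbounded operators\<close>

text \<open>A partially defined operator is identified with its graph, a set of pairs \<open>(x, A x)\<close>, so
  that equality and inclusion of operators include their domains. The composition \<open>B A\<close> is
  the relational composition \<open>A O B\<close> (note the order), and the inverse is the converse relation.\<close>

type_synonym ('a, 'b) partial_op = "('a \<times> 'b) set"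

definition linear_op :: "('a::complex_normed_vector, 'b::complex_normed_vector) partial_op \<Rightarrow> bool" where
  "linear_op A \<longleftrightarrow> single_valued A \<and> (0, 0) \<in> A
     \<and> (\<forall>x u y v. (x, u) \<in> A \<and> (y, v) \<in> A \<longrightarrow> (x + y, u + v) \<in> A)
     \<and> (\<forall>c x u. (x, u) \<in> A \<longrightarrow> (c *\<^sub>C x, c *\<^sub>C u) \<in> A)"

definition densely_defined :: "('a::topological_space, 'b) partial_op \<Rightarrow> bool" where
  "densely_defined A \<longleftrightarrow> closure (Domain A) = UNIV"

definition adjoint_op ::
    "('a::complex_hilbert_space, 'b::complex_hilbert_space) partial_op \<Rightarrow> ('b, 'a) partial_op" where
  "adjoint_op A = {(y, w). \<forall>x u. (x, u) \<in> A \<longrightarrow> cinner u y = cinner x w}"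

definition self_adjoint_op :: "('a::complex_hilbert_space, 'a) partial_op \<Rightarrow> bool" where
  "self_adjoint_op A \<longleftrightarrow> linear_op A \<and> densely_defined A \<and> adjoint_op A = A"

definition graph_of :: "('a::real_normed_vector \<Rightarrow>\<^sub>L 'b::real_normed_vector) \<Rightarrow> ('a, 'b) partial_op" where
  "graph_of L = {(x, y). y = blinfun_apply L x}"

definition complex_linear :: "('a::complex_normed_vector \<Rightarrow>\<^sub>L 'b::complex_normed_vector) \<Rightarrow> bool" where
  "complex_linear L \<longleftrightarrow> (\<forall>c x. L (c *\<^sub>C x) = c *\<^sub>C L x)"

definition compact_op :: "('a::complex_normed_vector \<Rightarrow>\<^sub>L 'b::complex_normed_vector) \<Rightarrow> bool" where
  "compact_op L \<longleftrightarrow> complex_linear L \<and> compact (closure (blinfun_apply L ` cball 0 1))"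

definition resolvent_op :: "('a::complex_normed_vector, 'a) partial_op \<Rightarrow> complex \<Rightarrow> ('a, 'a) partial_op" where
  "resolvent_op G z = {(x, u - z *\<^sub>C x) |x u. (x, u) \<in> G}\<inverse>"

definition resolvent_set :: "('a::complex_normed_vector, 'a) partial_op \<Rightarrow> complex set" where
  "resolvent_set G = {z. \<exists>R. complex_linear R \<and> resolvent_op G z = graph_of R}"

definition relatively_compact_op ::
    "('a::complex_normed_vector, 'a) partial_op \<Rightarrow> ('a, 'a) partial_op \<Rightarrow> bool" where
  "relatively_compact_op V G \<longleftrightarrow> Domain G \<subseteq> Domain V
     \<and> (\<exists>z \<in> resolvent_set G. \<exists>K. compact_op K \<and> resolvent_op G z O V = graph_of K)"

text \<open>\<open>perturb H V r\<close> is \<open>H + r V\<close> on the intersection of the two domains.\<close>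

definition perturb ::
    "('a::real_vector, 'a) partial_op \<Rightarrow> ('a, 'a) partial_op \<Rightarrow> real \<Rightarrow> ('a, 'a) partial_op" where
  "perturb H V r = {(x, u + r *\<^sub>R v) |x u v. (x, u) \<in> H \<and> (x, v) \<in> V}"

definition operator_line ::
    "('a::real_vector, 'a) partial_op \<Rightarrow> ('a, 'a) partial_op \<Rightarrow> ('a, 'a) partial_op set" where
  "operator_line H V = range (perturb H V)"

definition perturbation_setting ::
    "('a::complex_hilbert_space, 'a) partial_op \<Rightarrow> ('a, 'a) partial_op \<Rightarrow> 'a set \<Rightarrow> bool" where
  "perturbation_setting H V D \<longleftrightarrow> self_adjoint_op H \<and> self_adjoint_op V
     \<and> closure D = UNIV \<and> D \<subseteq> Domain V
     \<and> (\<forall>G \<in> operator_line H V.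
          self_adjoint_op G \<and> Domain G = D \<and> relatively_compact_op V G)"

section \<open>Rigging operators\<close>

text \<open>\<open>extends_sandwich F G z T\<close>: the bounded operator \<open>T\<close> is a compact extension of
  \<open>F (G - z)\<inverse> F\<^sup>*\<close>. When \<open>F\<^sup>*\<close> is densely defined and \<open>(G - z)\<inverse>\<close> maps into the domain of \<open>F\<close>,
  there is at most one such \<open>T\<close>.\<close>

definition extends_sandwich ::
    "('h::complex_hilbert_space, 'k::complex_hilbert_space) partial_op \<Rightarrow> ('h, 'h) partial_op
      \<Rightarrow> complex \<Rightarrow> ('k \<Rightarrow>\<^sub>L 'k) \<Rightarrow> bool" where
  "extends_sandwich F G z T \<longleftrightarrow>
     compact_op T \<and> adjoint_op F O resolvent_op G z O F \<subseteq> graph_of T"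

definition sandwiched_resolvent ::
    "('h::complex_hilbert_space, 'k::complex_hilbert_space) partial_op \<Rightarrow> ('h, 'h) partial_op
      \<Rightarrow> complex \<Rightarrow> ('k \<Rightarrow>\<^sub>L 'k)" where
  "sandwiched_resolvent F G z = (THE T. extends_sandwich F G z T)"

definition regular_points ::
    "('h::complex_hilbert_space, 'h) partial_op \<Rightarrow> ('h, 'k::complex_hilbert_space) partial_op
      \<Rightarrow> real set" where
  "regular_points G F =
     {lam. \<exists>T. ((\<lambda>y. sandwiched_resolvent F G (Complex lam y)) \<longlongrightarrow> T) (at_right 0)}"

text \<open>The bounded operator \<open>J\<close> with \<open>V = F\<^sup>* J F\<close> is carried along explicitly. Trivial co-kernel
  means that the range is dense.\<close>

definition admissible_rigging ::
    "('h::complex_hilbert_space, 'h) partial_op \<Rightarrow> ('h, 'h) partial_op \<Rightarrow> 'h set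
      \<Rightarrow> ('h, 'k::complex_hilbert_space) partial_op \<Rightarrow> ('k \<Rightarrow>\<^sub>L 'k) \<Rightarrow> bool" where
  "admissible_rigging H V D F J \<longleftrightarrow>
     linear_op F \<and> closed F \<and> densely_defined F
     \<and> (\<forall>x. (x, 0) \<in> F \<longrightarrow> x = 0) \<and> closure (Range F) = UNIV
     \<and> D \<subseteq> Domain F
     \<and> self_adjoint_op (graph_of J) \<and> V = F O graph_of J O adjoint_op F
     \<and> (\<forall>G \<in> operator_line H V. \<forall>z. Im z \<noteq> 0 \<longrightarrow> (\<exists>T. extends_sandwich F G z T))
     \<and> (\<forall>G \<in> operator_line H V. - regular_points G F \<in> null_sets lebesgue)"

definition essentially_regular ::
    "real \<Rightarrow> ('h::complex_hilbert_space, 'h) partial_op set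
      \<Rightarrow> ('h, 'k::complex_hilbert_space) partial_op \<Rightarrow> bool" where
  "essentially_regular lam \<A> F \<longleftrightarrow> (\<exists>G \<in> \<A>. lam \<in> regular_points G F)"

definition resonant_at ::
    "('h::complex_hilbert_space, 'h) partial_op \<Rightarrow> ('h, 'k::complex_hilbert_space) partial_op
      \<Rightarrow> real \<Rightarrow> bool" where
  "resonant_at G F lam \<longleftrightarrow> lam \<notin> regular_points G F"

definition regularizing_direction ::
    "('h::complex_hilbert_space, 'h) partial_op \<Rightarrow> ('h, 'h) partial_op
      \<Rightarrow> ('h, 'k::complex_hilbert_space) partial_op \<Rightarrow> real \<Rightarrow> bool" where
  "regularizing_direction V H F lam \<longleftrightarrow> (\<exists>r. lam \<in> regular_points (perturb H V r) F)"

section \<open>Resonance index\<close>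

definition operator_A ::
    "('h::complex_hilbert_space, 'h) partial_op \<Rightarrow> ('h, 'h) partial_op
      \<Rightarrow> ('h, 'k::complex_hilbert_space) partial_op \<Rightarrow> ('k \<Rightarrow>\<^sub>L 'k) \<Rightarrow> complex
      \<Rightarrow> real \<Rightarrow> ('k \<Rightarrow>\<^sub>L 'k)" where
  "operator_A H V F J z s = sandwiched_resolvent F (perturb H V s) z o\<^sub>L J"

text \<open>Holomorphy with respect to the norm of the target space.\<close>

definition norm_holomorphic_on :: "(complex \<Rightarrow> 'a::complex_normed_vector) \<Rightarrow> complex set \<Rightarrow> bool" where
  "norm_holomorphic_on M S \<longleftrightarrow> (\<forall>s \<in> S. \<exists>D. (M has_derivative (\<lambda>h. h *\<^sub>C D)) (at s within S))"

text \<open>\<open>M\<close> is a meromorphic extension to the complex plane, with set of poles \<open>S\<close>, of an operator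
  function \<open>A\<close> on the real line. Every point of \<open>S\<close> is a genuine pole of some order \<open>n > 0\<close>, so
  that \<open>S\<close> is uniquely determined by \<open>A\<close>.\<close>

definition meromorphic_extension ::
    "(real \<Rightarrow> ('k::complex_normed_vector \<Rightarrow>\<^sub>L 'k)) \<Rightarrow> (complex \<Rightarrow> ('k \<Rightarrow>\<^sub>L 'k)) \<Rightarrow> complex set \<Rightarrow> bool" where
  "meromorphic_extension A M S \<longleftrightarrow>
     (\<forall>p. \<not> p islimpt S)
     \<and> norm_holomorphic_on M (- S) \<and> (\<forall>s \<in> - S. complex_linear (M s))
     \<and> (\<forall>p \<in> S. \<exists>n > 0. \<exists>L. L \<noteq> 0 \<and> ((\<lambda>s. (s - p) ^ n *\<^sub>C M s) \<longlongrightarrow> L) (at p))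
     \<and> (\<forall>s. complex_of_real s \<notin> S \<and> M (complex_of_real s) = A s)"

definition extension_poles :: "(real \<Rightarrow> ('k::complex_normed_vector \<Rightarrow>\<^sub>L 'k)) \<Rightarrow> complex set" where
  "extension_poles A = {r. \<exists>M S. meromorphic_extension A M S \<and> r \<in> S}"

definition algebraic_multiplicity ::
    "('k::complex_normed_vector \<Rightarrow>\<^sub>L 'k) \<Rightarrow> complex \<Rightarrow> nat" where
  "algebraic_multiplicity T \<mu> =
     complex_vector.dim {x. \<exists>n. ((\<lambda>v. T v - \<mu> *\<^sub>C v) ^^ n) x = 0}"

text \<open>The multiplicity of a pole \<open>r\<close> is that of the eigenvalue \<open>1 / (s - r)\<close> of \<open>A s\<close>. For the
  functions considered here it is the same for all real \<open>s\<close>, and \<open>s = 0\<close> is used.\<close>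

definition pole_multiplicity ::
    "(real \<Rightarrow> ('k::complex_normed_vector \<Rightarrow>\<^sub>L 'k)) \<Rightarrow> complex \<Rightarrow> nat" where
  "pole_multiplicity A r = algebraic_multiplicity (A 0) (1 / (0 - r))"

text \<open>The number, with multiplicities, of poles of \<open>operator_A H V F J (lam + i y)\<close> in \<open>U\<close> that
  converge to \<open>0\<close> as \<open>y\<close> decreases to \<open>0\<close>: for every sufficiently small radius \<open>\<epsilon>\<close>, this is the number
  of poles in \<open>U\<close> within distance \<open>\<epsilon>\<close> of \<open>0\<close>, for all sufficiently small \<open>y > 0\<close>.\<close>

definition split_pole_count ::
    "('h::complex_hilbert_space, 'h) partial_op \<Rightarrow> ('h, 'h) partial_op
      \<Rightarrow> ('h, 'k::complex_hilbert_space) partial_op \<Rightarrow> ('k \<Rightarrow>\<^sub>L 'k) \<Rightarrow> real \<Rightarrow> complex set \<Rightarrow> nat" where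
  "split_pole_count H V F J lam U =
     (THE n. \<forall>\<^sub>F \<epsilon> in at_right 0. \<forall>\<^sub>F y in at_right 0.
        (\<Sum>r \<in> extension_poles (operator_A H V F J (Complex lam y)) \<inter> U \<inter> ball 0 \<epsilon>.
           pole_multiplicity (operator_A H V F J (Complex lam y)) r) = n)"

definition resonance_index ::
    "('h::complex_hilbert_space, 'h) partial_op \<Rightarrow> ('h, 'h) partial_op
      \<Rightarrow> ('h, 'k::complex_hilbert_space) partial_op \<Rightarrow> ('k \<Rightarrow>\<^sub>L 'k) \<Rightarrow> real \<Rightarrow> int" where
  "resonance_index H V F J lam =
     int (split_pole_count H V F J lam {r. Im r > 0}) - int (split_pole_count H V F J lam {r. Im r < 0})"

end

theory Submission
  imports Defs "HOL-Complex_Analysis.Conformal_Mappings"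
begin

text \<open>For non-real \<open>z\<close> put \<open>R = (H - z)\<inverse>\<close>. The compact operator \<open>B = V R\<close> on \<open>\<H>\<close> does not involve the rigging
  operator, and the bounded injective operator \<open>X = F R\<close> intertwines it with \<open>A = T\<^sub>z(H) J\<close>, that is
  \<open>X B = A X\<close>. The range of \<open>A\<close> lies in the closure of the range of \<open>X\<close>, and the Riesz decompositions of
  \<open>A\<close> and \<open>B\<close> then show that \<open>X\<close> maps the generalized eigenspaces of \<open>B\<close> for non-zero eigenvalues onto those
  of \<open>A\<close>. The second resolvent identity makes \<open>A (1 + s A)\<inverse>\<close> the meromorphic continuation of \<open>A\<^sub>z(s)\<close>, so
  its poles are the \<open>r\<close> for which \<open>- 1 / r\<close> is an eigenvalue of \<open>A\<close>. Hence poles and multiplicities can be read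
  off from \<open>B\<close> already for each fixed \<open>z = \<lambda> + i y\<close>, and no limit \<open>y \<rightarrow> 0\<close> is needed.\<close>

section \<open>Closed subspaces and proper operators\<close>

text \<open>The obstacle is that \<open>X\<close> is far from a similarity. Its inverse is unbounded
  in general, and its range, the image of \<open>D\<close> under \<open>F\<close>, is not known to
  be dense, since \<open>D\<close> need not be a core of \<open>F\<close>. Carrying generalized
  eigenvectors from \<open>B\<close> to \<open>A\<close> is immediate; the way back needs bounded
  Riesz projections on both sides and the closedness of the images of the eigenspaces. Boundedness
  of \<open>X\<close> also has to be earned: it comes by duality from the boundedness of the
  sandwiched resolvent at the conjugate point. Riesz theory is set up with Drazin inverses because
  one bounded operator then serves three ends: it inverts 1 + s A off the singular set, isolates
  each eigenvalue, and controls the Laurent expansion at a pole. The last point matters because a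
  pole is defined through an arbitrary meromorphic extension: every extension must be shown to have
  its poles in the singular set, and every singular point to be a genuine pole of one.\<close>

lemma closed_subspace_orthogonal_decomposition:
  fixes U :: "'a::{real_inner,complete_space} set"
  assumes "closed U" "subspace U"
  obtains p where "p \<in> U" "\<And>u. u \<in> U \<Longrightarrow> inner (x - p) u = 0"
proof -
  have ne: "U \<noteq> {}" using subspace_0[OF assms(2)] by auto
  define d where "d = infdist x U"
  have d0: "d \<ge> 0" by (simp add: d_def infdist_nonneg)
  have dle: "d \<le> norm (x - u)" if "u \<in> U" for u
    using infdist_le[OF that, of x] by (simp add: d_def dist_norm)
  have "\<exists>u\<in>U. (norm (x - u))\<^sup>2 < d\<^sup>2 + inverse (real (Suc n))" for n
  proof -
    have "d < sqrt (d\<^sup>2 + inverse (real (Suc n)))"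
      by (rule real_less_rsqrt) simp
    then obtain u where u: "u \<in> U" "dist x u < sqrt (d\<^sup>2 + inverse (real (Suc n)))"
      using ne unfolding d_def infdist_notempty[OF ne]
      by (metis (no_types, lifting) cINF_less_iff bdd_below_image_dist)
    have "(norm (x - u))\<^sup>2 < (sqrt (d\<^sup>2 + inverse (real (Suc n))))\<^sup>2"
      using u(2) by (intro power_strict_mono) (auto simp: dist_norm)
    also have "\<dots> = d\<^sup>2 + inverse (real (Suc n))"
      by (simp add: add_nonneg_nonneg)
    finally show ?thesis using u(1) by blast
  qed
  then obtain p where p: "\<And>n. p n \<in> U" "\<And>n. (norm (x - p n))\<^sup>2 < d\<^sup>2 + inverse (real (Suc n))"
    by metis
  \<comment> \<open>Parallelogram law. The squared distances exceed \<open>d\<^sup>2\<close> by at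
    most 1/(n+1), so the errors simply add.\<close>
  have par: "(norm (p m - p n))\<^sup>2 \<le> 2 * inverse (real (Suc m)) + 2 * inverse (real (Suc n))" for m n
  proof -
    have "(1/2) *\<^sub>R (p m + p n) \<in> U"
      using p(1) assms(2) by (simp add: subspace_add subspace_scale)
    from dle[OF this] have "d\<^sup>2 \<le> (norm (x - (1/2) *\<^sub>R (p m + p n)))\<^sup>2"
      using d0 by (simp add: power_mono)
    moreover have "(norm (p m - p n))\<^sup>2 = 2 * (norm (x - p m))\<^sup>2 + 2 * (norm (x - p n))\<^sup>2
        - 4 * (norm (x - (1/2) *\<^sub>R (p m + p n)))\<^sup>2"
      by (simp add: power2_norm_eq_inner inner_commute algebra_simps)
    ultimately show ?thesis using p(2)[of m] p(2)[of n] by linarith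
  qed
  have "Cauchy p"
  proof (rule metric_CauchyI)
    fix e :: real assume e: "e > 0"
    then obtain N where N: "inverse (real (Suc N)) < e\<^sup>2 / 4"
      using reals_Archimedean[of "e\<^sup>2 / 4"] by auto
    show "\<exists>M. \<forall>m\<ge>M. \<forall>n\<ge>M. dist (p m) (p n) < e"
    proof (intro exI allI impI)
      fix m n assume mn: "m \<ge> N" "n \<ge> N"
      have "inverse (real (Suc m)) \<le> inverse (real (Suc N))" "inverse (real (Suc n)) \<le> inverse (real (Suc N))"
        using mn by (auto intro!: le_imp_inverse_le)
      with par[of m n] N have "(norm (p m - p n))\<^sup>2 < e\<^sup>2" by linarith
      then show "dist (p m) (p n) < e"
        using e by (simp add: dist_norm power_less_imp_less_base)
    qed
  qed
  then obtain q where q: "p \<longlonglongrightarrow> q"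
    using Cauchy_convergent convergent_def by blast
  have qU: "q \<in> U"
    using closed_sequentially[OF assms(1)] p(1) q by blast
  have qd: "(norm (x - q))\<^sup>2 \<le> d\<^sup>2"
  proof -
    have "(\<lambda>n. (norm (x - p n))\<^sup>2) \<longlonglongrightarrow> (norm (x - q))\<^sup>2"
      by (intro tendsto_intros q)
    moreover have "(\<lambda>n. d\<^sup>2 + inverse (real (Suc n))) \<longlonglongrightarrow> d\<^sup>2 + 0"
      by (intro tendsto_intros LIMSEQ_inverse_real_of_nat)
    ultimately show ?thesis
      using p(2) by (auto intro: LIMSEQ_le less_imp_le)
  qed
  have "inner (x - q) u = 0" if u: "u \<in> U" for u
  proof (cases "u = 0")
    case False
    \<comment> \<open>The minimizer in \<open>t\<close> of the squared distance from
      \<open>x\<close> to \<open>q + t u\<close>.\<close>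
    define t where "t = inner (x - q) u / inner u u"
    have iu: "inner u u > 0" using False by simp
    have "q + t *\<^sub>R u \<in> U" using qU u assms(2) by (simp add: subspace_add subspace_scale)
    from dle[OF this] have "d\<^sup>2 \<le> (norm (x - (q + t *\<^sub>R u)))\<^sup>2"
      using d0 by (simp add: power_mono)
    also have "\<dots> = (norm (x - q))\<^sup>2 - 2 * t * inner (x - q) u + t * t * inner u u"
      by (simp add: power2_norm_eq_inner inner_commute algebra_simps)
    also have "\<dots> = (norm (x - q))\<^sup>2 - (inner (x - q) u)\<^sup>2 / inner u u"
      using iu by (simp add: t_def power2_eq_square field_simps)
    finally have "(inner (x - q) u)\<^sup>2 / inner u u \<le> 0" using qd by linarith
    then have "(inner (x - q) u)\<^sup>2 \<le> 0"
      using iu by (simp add: divide_le_0_iff)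
    then show ?thesis by simp
  qed simp
  with qU that show ?thesis by blast
qed

text \<open>For bounded linear \<open>f\<close> on a complete space and \<open>U = UNIV\<close> this
  is the upper semi-Fredholm property: finite-dimensional kernel and closed range. The sequential
  form is stable under composition, so it passes to powers of \<open>A - \<mu>\<close> without
  expanding them, and it stands in for finite dimension.\<close>

definition proper_on :: "('a::metric_space \<Rightarrow> 'b::topological_space) \<Rightarrow> 'a set \<Rightarrow> bool" where
  "proper_on f U \<longleftrightarrow> (\<forall>x. (\<forall>n::nat. x n \<in> U) \<and> bounded (range x) \<and> convergent (\<lambda>n. f (x n))
     \<longrightarrow> (\<exists>r. strict_mono r \<and> convergent (x \<circ> r)))"

lemma proper_onD:
  assumes "proper_on f U" "\<And>n::nat. x n \<in> U" "bounded (range x)" "convergent (\<lambda>n. f (x n))"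
  obtains r l where "strict_mono (r :: nat \<Rightarrow> nat)" "(x \<circ> r) \<longlonglongrightarrow> l"
  using assms unfolding proper_on_def convergent_def by meson

lemma proper_on_subset: "proper_on f U \<Longrightarrow> W \<subseteq> U \<Longrightarrow> proper_on f W"
  unfolding proper_on_def by blast

lemma proper_on_compose:
  fixes f :: "'a::real_normed_vector \<Rightarrow> 'b::real_normed_vector"
  assumes f: "bounded_linear f" "proper_on f UNIV" and g: "proper_on g UNIV"
  shows "proper_on (\<lambda>x. g (f x)) UNIV"
  unfolding proper_on_def
proof (intro allI impI, elim conjE)
  fix x :: "nat \<Rightarrow> 'a"
  assume b: "bounded (range x)" and c: "convergent (\<lambda>n. g (f (x n)))"
  have "bounded (range (\<lambda>n. f (x n)))"
    using bounded_linear_image[OF b f(1)] by (simp add: image_image)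
  with c g obtain r l where r: "strict_mono (r :: nat \<Rightarrow> nat)" "((\<lambda>n. f (x n)) \<circ> r) \<longlonglongrightarrow> l"
    by (elim proper_onD[where x = "\<lambda>n. f (x n)"]) auto
  have "bounded (range (x \<circ> r))" using b by (rule bounded_subset) auto
  moreover have "convergent (\<lambda>n. f ((x \<circ> r) n))"
    using r(2) by (auto simp: convergent_def o_def)
  ultimately obtain r' l' where "strict_mono (r' :: nat \<Rightarrow> nat)" "((x \<circ> r) \<circ> r') \<longlonglongrightarrow> l'"
    using f(2) by (elim proper_onD[where x = "x \<circ> r"]) auto
  then show "\<exists>r. strict_mono r \<and> convergent (x \<circ> r)"
    using r(1) by (intro exI[of _ "r \<circ> r'"]) (auto simp: strict_mono_o o_assoc convergent_def)
qed

lemma proper_on_funpow: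
  fixes f :: "'a::real_normed_vector \<Rightarrow> 'a"
  assumes "bounded_linear f" "proper_on f UNIV"
  shows "bounded_linear (f ^^ n) \<and> proper_on (f ^^ n) UNIV"
proof (induction n)
  case 0
  have "proper_on id (UNIV :: 'a set)"
    unfolding proper_on_def by (auto intro!: exI[of _ id] simp: strict_mono_id)
  then show ?case by (simp add: id_def[symmetric] bounded_linear_ident[folded id_def])
next
  case (Suc n)
  then show ?case
    using bounded_linear_compose[OF assms(1), of "f ^^ n"] proper_on_compose[of "f ^^ n" f] assms
    by (simp add: o_def)
qed

text \<open>Normalized counterexamples are unit vectors whose images tend to 0. Properness extracts
  a limit, which would be a unit vector of \<open>U\<close> in the kernel.\<close>

lemma proper_on_bounded_below:
  fixes f :: "'a::real_normed_vector \<Rightarrow> 'b::real_normed_vector"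
  assumes f: "bounded_linear f" and U: "closed U" "subspace U" and p: "proper_on f U"
    and inj: "\<And>x. x \<in> U \<Longrightarrow> f x = 0 \<Longrightarrow> x = 0"
  obtains c where "c > 0" "\<And>x. x \<in> U \<Longrightarrow> c * norm x \<le> norm (f x)"
proof -
  interpret f: bounded_linear f by fact
  have "\<exists>c>0. \<forall>x\<in>U. c * norm x \<le> norm (f x)"
  proof (rule ccontr)
    assume "\<not> ?thesis"
    then have "\<exists>x\<in>U. norm (f x) < inverse (real (Suc n)) * norm x" for n
      by (metis inverse_positive_iff_positive not_le of_nat_0_less_iff zero_less_Suc)
    then obtain y where y: "\<And>n. y n \<in> U" "\<And>n. norm (f (y n)) < inverse (real (Suc n)) * norm (y n)"
      by metis
    have y0: "norm (y n) > 0" for n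
      using y(2)[of n] by (cases "y n = 0") (auto simp: f.zero)
    define x where "x n = (1 / norm (y n)) *\<^sub>R y n" for n
    have xU: "x n \<in> U" for n using y(1) U(2) by (simp add: x_def subspace_scale)
    have nx: "norm (x n) = 1" for n using y0[of n] by (simp add: x_def)
    have fx: "norm (f (x n)) \<le> inverse (real (Suc n))" for n
    proof -
      have "norm (f (x n)) = norm (f (y n)) / norm (y n)"
        by (simp add: x_def f.scaleR divide_inverse)
      also have "\<dots> \<le> inverse (real (Suc n))"
        using y(2)[of n] y0[of n] by (simp add: divide_simps)
      finally show ?thesis .
    qed
    have fl: "(\<lambda>n. f (x n)) \<longlonglongrightarrow> 0"
      by (rule Lim_null_comparison[OF _ LIMSEQ_inverse_real_of_nat]) (rule eventuallyI, rule fx)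
    have "bounded (range x)" using nx by (auto simp: bounded_iff)
    with p xU fl obtain r l where r: "strict_mono (r :: nat \<Rightarrow> nat)" "(x \<circ> r) \<longlonglongrightarrow> l"
      by (elim proper_onD[where x = x]) (auto simp: convergent_def)
    have "l \<in> U" using closed_sequentially[OF U(1) _ r(2)] xU by simp
    moreover have "f l = 0"
    proof -
      have "(\<lambda>n. f ((x \<circ> r) n)) \<longlonglongrightarrow> f l" by (rule f.tendsto[OF r(2)])
      moreover have "((\<lambda>n. f (x n)) \<circ> r) \<longlonglongrightarrow> 0" by (rule LIMSEQ_subseq_LIMSEQ[OF fl r(1)])
      ultimately show ?thesis by (simp add: o_def LIMSEQ_unique)
    qed
    moreover have "norm l = 1"
      using tendsto_norm[OF r(2)] nx by (simp add: o_def LIMSEQ_const_iff)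
    ultimately show False using inj by force
  qed
  with that show ?thesis by blast
qed

lemma proper_on_closed_image:
  fixes f :: "'a::{real_normed_vector,complete_space} \<Rightarrow> 'b::real_normed_vector"
  assumes "bounded_linear f" "closed U" "subspace U" "proper_on f U"
    and "\<And>x. x \<in> U \<Longrightarrow> f x = 0 \<Longrightarrow> x = 0"
  shows "closed (f ` U)"
proof -
  obtain c where c: "c > 0" "\<And>x. x \<in> U \<Longrightarrow> c * norm x \<le> norm (f x)"
    using proper_on_bounded_below[OF assms] by blast
  have "complete U"
    using assms(2) by (simp add: complete_eq_closed)
  then have "complete (f ` U)"
    using complete_isometric_image[OF c(1) assms(3,1)] c(2) by blast
  then show ?thesis by (rule complete_imp_closed)
qed

text \<open>On the orthogonal complement of its kernel \<open>f\<close> is injective and has the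
  same range, so the injective case applies there.\<close>

lemma proper_on_closed_range:
  fixes f :: "'a::{real_inner,complete_space} \<Rightarrow> 'b::real_normed_vector"
  assumes f: "bounded_linear f" and p: "proper_on f UNIV"
  shows "closed (range f)"
proof -
  interpret f: bounded_linear f by fact
  define N where "N = {x. f x = 0}"
  define U where "U = {x. \<forall>k\<in>N. inner x k = 0}"
  have N: "closed N" "subspace N"
    unfolding N_def
    by (intro closed_Collect_eq continuous_intros f.continuous_on)
       (auto simp: subspace_def f.zero f.add f.scaleR)
  have "U = (\<Inter>k\<in>N. {x. inner x k = 0})" by (auto simp: U_def)
  then have "closed U"
    by (auto intro!: closed_Collect_eq continuous_on_inner continuous_on_id continuous_on_const)
  moreover have "subspace U" by (auto simp: U_def subspace_def inner_add_left)
  moreover have "proper_on f U" using p by (rule proper_on_subset) simp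
  moreover have "x = 0" if "x \<in> U" "f x = 0" for x
    using that by (auto simp: U_def N_def)
  ultimately have "closed (f ` U)" using f by (intro proper_on_closed_image)
  moreover have "range f = f ` U"
  proof -
    have "f x \<in> f ` U" for x
    proof -
      obtain k where k: "k \<in> N" "\<And>u. u \<in> N \<Longrightarrow> inner (x - k) u = 0"
        using closed_subspace_orthogonal_decomposition[OF N, of x] by blast
      then have "x - k \<in> U" "f x = f (x - k)" by (auto simp: U_def N_def f.diff)
      then show ?thesis by blast
    qed
    then show ?thesis by auto
  qed
  ultimately show ?thesis by simp
qed

section \<open>Riesz theory of compact operators\<close>

lemma bounded_linear_scaleC_right: "bounded_linear (\<lambda>x. c *\<^sub>C x)"
  by (rule bounded_linear_intro[where K = "cmod c"])
     (simp_all add: scaleC_add_right norm_scaleC mult.commute scaleC_scaleC flip: scaleC_of_real)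

lemma complex_linear_scaleC: "complex_linear L \<Longrightarrow> L (c *\<^sub>C x) = c *\<^sub>C L x"
  by (simp add: complex_linear_def)

lemma compact_op_subsequence:
  fixes x :: "nat \<Rightarrow> 'a::complex_normed_vector"
  assumes A: "compact_op A" and b: "bounded (range x)"
  obtains r l where "strict_mono (r :: nat \<Rightarrow> nat)" "(\<lambda>n. A (x (r n))) \<longlonglongrightarrow> l"
proof -
  obtain C where C: "C > 0" "\<And>n. norm (x n) \<le> C"
    using b by (auto simp: bounded_pos)
  define y where "y n = A ((1 / C) *\<^sub>R x n)" for n
  have "y n \<in> closure (blinfun_apply A ` cball 0 1)" for n
    unfolding y_def by (rule subsetD[OF closure_subset], rule imageI) (use C in \<open>simp add: divide_simps\<close>)
  moreover have "seq_compact (closure (blinfun_apply A ` cball 0 1))"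
    using A by (simp add: compact_op_def compact_eq_seq_compact_metric)
  ultimately obtain l r where r: "strict_mono (r :: nat \<Rightarrow> nat)" "(y \<circ> r) \<longlonglongrightarrow> l"
    by (metis seq_compactE)
  have "(\<lambda>n. C *\<^sub>R y (r n)) \<longlonglongrightarrow> C *\<^sub>R l"
    using r(2) by (intro tendsto_intros) (simp add: o_def)
  moreover have "C *\<^sub>R y n = A (x n)" for n
    using C(1) by (simp add: y_def blinfun.scaleR_right)
  ultimately show ?thesis using that[OF r(1)] by simp
qed

lemma bounded_linear_shift:
  fixes A :: "'a::complex_normed_vector \<Rightarrow>\<^sub>L 'a"
  shows "bounded_linear (\<lambda>x. A x - \<mu> *\<^sub>C x)"
  by (intro bounded_linear_sub blinfun.bounded_linear_right bounded_linear_scaleC_right)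

text \<open>In \<open>\<mu> x = A x - (A x - \<mu> x)\<close> both terms on the right converge along
  a subsequence.\<close>

lemma compact_op_shift_proper:
  assumes A: "compact_op A" and mu: "\<mu> \<noteq> 0"
  shows "proper_on (\<lambda>x. A x - \<mu> *\<^sub>C x) UNIV"
  unfolding proper_on_def
proof (intro allI impI, elim conjE)
  fix x :: "nat \<Rightarrow> 'a"
  assume b: "bounded (range x)" and "convergent (\<lambda>n. A (x n) - \<mu> *\<^sub>C x n)"
  then obtain k where k: "(\<lambda>n. A (x n) - \<mu> *\<^sub>C x n) \<longlonglongrightarrow> k" by (auto simp: convergent_def)
  obtain r l where r: "strict_mono (r :: nat \<Rightarrow> nat)" "(\<lambda>n. A (x (r n))) \<longlonglongrightarrow> l"
    using compact_op_subsequence[OF A b] by blast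
  have "(\<lambda>n. A (x (r n)) - (A (x (r n)) - \<mu> *\<^sub>C x (r n))) \<longlonglongrightarrow> l - k"
    using r(2) LIMSEQ_subseq_LIMSEQ[OF k r(1)] by (intro tendsto_diff) (simp_all add: o_def)
  then have "(\<lambda>n. (1 / \<mu>) *\<^sub>C \<mu> *\<^sub>C x (r n)) \<longlonglongrightarrow> (1 / \<mu>) *\<^sub>C (l - k)"
    by (intro bounded_linear.tendsto[OF bounded_linear_scaleC_right]) simp
  then have "(x \<circ> r) \<longlonglongrightarrow> (1 / \<mu>) *\<^sub>C (l - k)"
    using mu by (simp add: o_def scaleC_scaleC scaleC_one)
  with r(1) show "\<exists>r. strict_mono r \<and> convergent (x \<circ> r)"
    by (auto simp: convergent_def)
qed

text \<open>Riesz's lemma in its sharp Hilbert space form: normalize the component of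
  \<open>x\<close> orthogonal to \<open>U\<close>.\<close>

lemma unit_orthogonal_vector:
  fixes U :: "'a::{real_inner,complete_space} set"
  assumes U: "closed U" "subspace U" and S: "subspace S" "U \<subseteq> S" "x \<in> S" "x \<notin> U"
  obtains y where "y \<in> S" "norm y = 1" "\<And>u. u \<in> U \<Longrightarrow> inner y u = 0"
proof -
  obtain p where p: "p \<in> U" "\<And>u. u \<in> U \<Longrightarrow> inner (x - p) u = 0"
    using closed_subspace_orthogonal_decomposition[OF U, of x] by blast
  have "x \<noteq> p" using p(1) S(4) by auto
  moreover have "x - p \<in> S" using p(1) S subspace_diff by blast
  ultimately show ?thesis
    using p(2) S(1) by (intro that[of "(1 / norm (x - p)) *\<^sub>R (x - p)"]) (auto simp: subspace_scale)
qed

text \<open>\<open>inner\<close> is only the real part of \<open>cinner\<close>, so real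
  orthogonality is not preserved when one argument is multiplied by \<open>\<mu>\<close>. Hence
  \<open>\<mu>\<close> is factored out first and Pythagoras is applied to \<open>y\<close> and
  \<open>w / \<mu>\<close>.\<close>

lemma norm_scaleC_add_orthogonal_ge:
  fixes y w :: "'a::complex_hilbert_space"
  assumes "norm y = 1" "\<mu> \<noteq> 0" "inner y ((1 / \<mu>) *\<^sub>C w) = 0"
  shows "cmod \<mu> \<le> norm (\<mu> *\<^sub>C y + w)"
proof -
  let ?w = "(1 / \<mu>) *\<^sub>C w"
  have "(norm (y + ?w))\<^sup>2 = 1 + (norm ?w)\<^sup>2"
    using assms(1,3) norm_add_Pythagorean[of y ?w] by (simp add: orthogonal_def)
  then have "1 \<le> (norm (y + ?w))\<^sup>2" by simp
  then have "1 \<le> norm (y + ?w)" by (metis norm_ge_zero one_power2 power2_le_imp_le)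
  then have "cmod \<mu> * 1 \<le> cmod \<mu> * norm (y + ?w)" by (intro mult_left_mono) auto
  also have "\<dots> = norm (\<mu> *\<^sub>C y + w)"
    using assms(2) by (simp add: norm_scaleC[symmetric] scaleC_add_right scaleC_scaleC scaleC_one)
  finally show ?thesis by simp
qed

lemma compact_op_no_separated_sequence:
  fixes x :: "nat \<Rightarrow> 'a::complex_normed_vector"
  assumes A: "compact_op A" and x: "\<And>n. norm (x n) = 1" and c: "c > 0"
    and sep: "\<And>m n. m < n \<Longrightarrow> c \<le> norm (A (x m) - A (x n))"
  shows False
proof -
  have "bounded (range x)" using x by (auto simp: bounded_iff)
  then obtain r l where r: "strict_mono (r :: nat \<Rightarrow> nat)" "(\<lambda>n. A (x (r n))) \<longlonglongrightarrow> l"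
    using compact_op_subsequence[OF A] by blast
  from r(2) have "Cauchy (\<lambda>n. A (x (r n)))" by (rule LIMSEQ_imp_Cauchy)
  then obtain N where N: "\<forall>m\<ge>N. \<forall>n\<ge>N. dist (A (x (r m))) (A (x (r n))) < c"
    using c by (metis metric_CauchyD)
  then have "dist (A (x (r N))) (A (x (r (Suc N)))) < c" by simp
  moreover have "r N < r (Suc N)" using r(1) by (simp add: strict_mono_Suc_iff)
  ultimately show False
    using sep[of "r N" "r (Suc N)"] by (simp add: dist_norm)
qed

text \<open>The Drazin inverse \<open>G\<close> packages the Riesz decomposition \<open>ker W\<^sup>m \<oplus> ran W\<^sup>m\<close>: the projection onto the
  first summand along the second is \<open>1 - W G\<close>.\<close>

definition is_drazin_inverse :: "('a::complex_normed_vector \<Rightarrow> 'a) \<Rightarrow> ('a \<Rightarrow>\<^sub>L 'a) \<Rightarrow> nat \<Rightarrow> bool" where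
  "is_drazin_inverse W G m \<longleftrightarrow> complex_linear G \<and> (\<forall>x. G (W x) = W (G x)) \<and> (\<forall>x. G (W (G x)) = G x)
     \<and> (\<forall>x. (W ^^ Suc m) (G x) = (W ^^ m) x)"

lemma is_drazin_inverseD:
  assumes "is_drazin_inverse W G m"
  shows "complex_linear G" "G (W x) = W (G x)" "G (W (G x)) = G x" "(W ^^ Suc m) (G x) = (W ^^ m) x"
  using assms unfolding is_drazin_inverse_def by blast+

context
  fixes A :: "'a::complex_hilbert_space \<Rightarrow>\<^sub>L 'a" and \<mu> :: complex and W
  assumes A: "compact_op A" and mu: "\<mu> \<noteq> 0"
  defines "W \<equiv> \<lambda>x. A x - \<mu> *\<^sub>C x"
begin

lemma shift_funpow: "bounded_linear (W ^^ n)" "proper_on (W ^^ n) UNIV"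
  using proper_on_funpow[OF bounded_linear_shift compact_op_shift_proper[OF A mu]]
  unfolding W_def by blast+

lemma shift_funpow_scaleC: "(W ^^ n) (c *\<^sub>C x) = c *\<^sub>C (W ^^ n) x"
proof (induction n)
  case (Suc n)
  have "complex_linear A" using A by (simp add: compact_op_def)
  then show ?case using Suc
    by (simp add: W_def complex_linear_scaleC complex_vector.scale_right_diff_distrib scaleC_scaleC mult.commute)
qed simp

lemma kernel_shift_funpow: "closed {x. (W ^^ n) x = 0}" "subspace {x. (W ^^ n) x = 0}"
proof -
  interpret L: bounded_linear "W ^^ n" by (rule shift_funpow)
  show "closed {x. (W ^^ n) x = 0}"
    by (intro closed_Collect_eq continuous_on_const L.continuous_on continuous_on_id)
  show "subspace {x. (W ^^ n) x = 0}"
    by (auto simp: subspace_def L.zero L.add L.scaleR)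
qed

lemma range_shift_funpow: "closed (range (W ^^ n))" "subspace (range (W ^^ n))"
proof -
  interpret L: bounded_linear "W ^^ n" by (rule shift_funpow)
  show "closed (range (W ^^ n))"
    using proper_on_closed_range shift_funpow by blast
  show "subspace (range (W ^^ n))"
    by (rule linear_subspace_image[OF L.linear_axioms]) simp
qed

text \<open>If the kernels grew forever, there would be unit vectors \<open>y n\<close> in the
  kernel of W^(n+1) orthogonal to the kernel of W^n. For m < n the difference
  \<open>A (y n) - A (y m)\<close> is \<open>\<mu> y n\<close> plus an element of the kernel of W^n,
  so its norm is at least \<open>cmod \<mu>\<close>, against compactness.\<close>

lemma finite_ascent: "\<exists>n. \<forall>x. (W ^^ Suc n) x = 0 \<longrightarrow> (W ^^ n) x = 0"
proof (rule ccontr)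
  assume "\<not> ?thesis"
  then obtain x where x: "\<And>n. (W ^^ Suc n) (x n) = 0" "\<And>n. (W ^^ n) (x n) \<noteq> 0" by metis
  have mono: "(W ^^ n) v = 0" if "(W ^^ m) v = 0" "m \<le> n" for m n v
  proof -
    have "(W ^^ n) v = (W ^^ (n - m)) ((W ^^ m) v)"
      using that(2) by (metis comp_apply funpow_add le_add_diff_inverse2)
    then show ?thesis
      using that(1) linear_0[OF bounded_linear.linear[OF shift_funpow(1)]] by simp
  qed
  have "\<exists>y. (W ^^ Suc n) y = 0 \<and> norm y = 1 \<and> (\<forall>u. (W ^^ n) u = 0 \<longrightarrow> inner y u = 0)" for n
  proof -
    have "{x. (W ^^ n) x = 0} \<subseteq> {x. (W ^^ Suc n) x = 0}"
      using mono[of n _ "Suc n"] by auto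
    then obtain y where "y \<in> {x. (W ^^ Suc n) x = 0}" "norm y = 1"
        "\<And>u. u \<in> {x. (W ^^ n) x = 0} \<Longrightarrow> inner y u = 0"
      using unit_orthogonal_vector[OF kernel_shift_funpow[of n] kernel_shift_funpow(2)[of "Suc n"], of "x n"] x by blast
    then show ?thesis by blast
  qed
  then obtain y where y: "\<And>n. (W ^^ Suc n) (y n) = 0" "\<And>n. norm (y n) = 1"
      "\<And>n u. (W ^^ n) u = 0 \<Longrightarrow> inner (y n) u = 0" by metis
  show False
  proof (rule compact_op_no_separated_sequence[OF A y(2)])
    show "cmod \<mu> > 0" using mu by simp
    fix m n :: nat assume mn: "m < n"
    define w where "w = W (y n) - W (y m) - \<mu> *\<^sub>C y m"
    interpret L: bounded_linear "W ^^ n" by (rule shift_funpow)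
    have "(W ^^ n) (W (y n)) = 0" using y(1)[of n] by (simp add: funpow_swap1)
    moreover have "(W ^^ n) (W (y m)) = 0"
      using mono[OF y(1)[of m], of "Suc n"] mn by (simp add: funpow_swap1)
    moreover have "(W ^^ n) (y m) = 0" using mono[OF y(1)[of m], of n] mn by simp
    ultimately have "(W ^^ n) ((1 / \<mu>) *\<^sub>C w) = 0" by (simp add: w_def shift_funpow_scaleC L.diff)
    then have "cmod \<mu> \<le> norm (\<mu> *\<^sub>C y n + w)"
      by (intro norm_scaleC_add_orthogonal_ge y mu)
    also have "\<mu> *\<^sub>C y n + w = A (y n) - A (y m)" by (simp add: w_def W_def)
    finally show "cmod \<mu> \<le> norm (A (y m) - A (y n))" by (simp add: norm_minus_commute)
  qed
qed

text \<open>Dual to \<open>finite_ascent\<close>: unit vectors in successive ranges, each orthogonal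
  to the next range. Projecting onto that range needs it closed, which properness of the powers
  provides.\<close>

lemma finite_descent: "\<exists>n. range (W ^^ n) \<subseteq> range (W ^^ Suc n)"
proof (rule ccontr)
  assume "\<not> ?thesis"
  then have x: "\<exists>x. x \<in> range (W ^^ n) \<and> x \<notin> range (W ^^ Suc n)" for n by blast
  have mono: "range (W ^^ n) \<subseteq> range (W ^^ m)" if "m \<le> n" for m n
  proof -
    have "(W ^^ n) v = (W ^^ m) ((W ^^ (n - m)) v)" for v
      using that by (metis comp_apply funpow_add le_add_diff_inverse)
    then show ?thesis by auto
  qed
  have "\<exists>y. y \<in> range (W ^^ n) \<and> norm y = 1 \<and> (\<forall>u\<in>range (W ^^ Suc n). inner y u = 0)" for n
  proof -
    obtain v where v: "v \<in> range (W ^^ n)" "v \<notin> range (W ^^ Suc n)" using x[of n] by blast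
    have "n \<le> Suc n" by simp
    from unit_orthogonal_vector[OF range_shift_funpow[of "Suc n"] range_shift_funpow(2)[of n] mono[OF this] v]
    show ?thesis by metis
  qed
  then obtain y where y: "\<And>n. y n \<in> range (W ^^ n)" "\<And>n. norm (y n) = 1"
      "\<And>n u. u \<in> range (W ^^ Suc n) \<Longrightarrow> inner (y n) u = 0" by metis
  show False
  proof (rule compact_op_no_separated_sequence[OF A y(2)])
    show "cmod \<mu> > 0" using mu by simp
    fix m n :: nat assume mn: "m < n"
    define w where "w = W (y m) - W (y n) - \<mu> *\<^sub>C y n"
    have 1: "W v \<in> range (W ^^ Suc k)" if "v \<in> range (W ^^ k)" for v k using that by auto
    have 2: "c *\<^sub>C v \<in> range (W ^^ k)" if "v \<in> range (W ^^ k)" for c v k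
      using that by (auto simp flip: shift_funpow_scaleC)
    have "W (y m) \<in> range (W ^^ Suc m)" "W (y n) \<in> range (W ^^ Suc m)" "\<mu> *\<^sub>C y n \<in> range (W ^^ Suc m)"
      using 1[OF y(1)[of m]] 1[OF y(1)[of n]] 2[OF y(1)[of n], of \<mu>]
        mono[of "Suc m" "Suc n"] mono[of "Suc m" n] mn by auto
    then have "w \<in> range (W ^^ Suc m)"
      unfolding w_def using range_shift_funpow(2) subspace_diff by blast
    then have "cmod \<mu> \<le> norm (\<mu> *\<^sub>C y m + w)"
      by (intro norm_scaleC_add_orthogonal_ge y mu 2)
    also have "\<mu> *\<^sub>C y m + w = A (y m) - A (y n)" by (simp add: w_def W_def)
    finally show "cmod \<mu> \<le> norm (A (y m) - A (y n))" .
  qed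
qed

text \<open>For \<open>m\<close> beyond ascent and descent, \<open>W\<close> maps
  \<open>R = ran W^m\<close> bijectively onto itself. \<open>G\<close> is the projection onto
  \<open>R\<close> followed by the inverse of \<open>W\<close> on \<open>R\<close>. The condition
  \<open>?P\<close> captures both at once, since W^m removes the nilpotent component of
  \<open>y\<close>.\<close>

lemma ex_drazin_inverse: "\<exists>G m. is_drazin_inverse W G m"
proof -
  obtain n1 where n1: "\<And>x. (W ^^ Suc n1) x = 0 \<Longrightarrow> (W ^^ n1) x = 0" using finite_ascent by blast
  obtain n2 where n2: "range (W ^^ n2) \<subseteq> range (W ^^ Suc n2)" using finite_descent by blast
  define m where "m = max n1 n2"
  have kerS: "(W ^^ n) x = 0" if "(W ^^ Suc n) x = 0" "n1 \<le> n" for n x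
  proof -
    have eq: "(W ^^ k) x = (W ^^ n1) ((W ^^ (k - n1)) x)" if "n1 \<le> k" for k
      using that by (metis comp_apply funpow_add le_add_diff_inverse)
    have "(W ^^ Suc n1) ((W ^^ (n - n1)) x) = 0"
      using that eq[of n] by (metis comp_apply funpow.simps(2))
    then show ?thesis using n1 eq[OF that(2)] by simp
  qed
  have ker: "(W ^^ m) x = 0" if "(W ^^ (k + m)) x = 0" for k x
    using that by (induction k) (use kerS in \<open>auto simp: m_def\<close>)
  have ranS: "range (W ^^ n) \<subseteq> range (W ^^ Suc n)" if "n2 \<le> n" for n
  proof -
    have eq: "W ^^ n = (W ^^ (n - n2)) \<circ> (W ^^ n2)" "W ^^ Suc n = (W ^^ (n - n2)) \<circ> (W ^^ Suc n2)"
      using that by (simp_all add: funpow_add[symmetric] Suc_diff_le del: funpow.simps)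
    show ?thesis unfolding eq image_comp[symmetric] using n2 by blast
  qed
  have ran: "range (W ^^ m) \<subseteq> range (W ^^ (k + m))" for k
  proof (induction k)
    case (Suc k)
    moreover have "n2 \<le> k + m" by (simp add: m_def)
    ultimately show ?case using ranS[of "k + m"] by (simp del: funpow.simps)
  qed simp
  define R where "R = range (W ^^ m)"
  let ?P = "\<lambda>y x. x \<in> R \<and> (W ^^ Suc m) x = (W ^^ m) y"
  interpret L: bounded_linear "W ^^ Suc m" by (rule shift_funpow)
  interpret L': bounded_linear "W ^^ m" by (rule shift_funpow)
  have R: "subspace R" "closed R" unfolding R_def by (rule range_shift_funpow)+
  have inj: "x = 0" if x: "x \<in> R" "(W ^^ Suc m) x = 0" for x
  proof -
    from x(1) obtain v where v: "x = (W ^^ m) v" by (auto simp: R_def)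
    then have "(W ^^ (Suc m + m)) v = 0" using x(2) by (simp add: funpow_add)
    then show ?thesis using ker v by blast
  qed
  have ex: "\<exists>x. ?P y x" for y
  proof -
    have "(W ^^ m) y \<in> range (W ^^ (Suc m + m))" using ran[of "Suc m"] by blast
    then obtain v where "(W ^^ m) y = (W ^^ Suc m) ((W ^^ m) v)" by (auto simp: funpow_add)
    then show ?thesis by (intro exI[of _ "(W ^^ m) v"]) (auto simp: R_def)
  qed
  have uniq: "x = x'" if "?P y x" "?P y x'" for x x' y
    using inj[of "x - x'"] that subspace_diff[OF R(1)] by (auto simp: L.diff simp del: funpow.simps)
  define g where "g y = (THE x. ?P y x)" for y
  have g: "?P y (g y)" for y
    unfolding g_def by (rule theI', rule ex_ex1I[OF ex], rule uniq)
  have geq: "g y = x" if "?P y x" for x y by (rule uniq[OF g that])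
  \<comment> \<open>This lower bound makes \<open>g\<close> bounded and takes the place of the open
    mapping theorem.\<close>
  obtain c where c: "c > 0" "\<And>x. x \<in> R \<Longrightarrow> c * norm x \<le> norm ((W ^^ Suc m) x)"
    using proper_on_bounded_below[OF shift_funpow(1) R(2,1) proper_on_subset[OF shift_funpow(2)], of "Suc m"] inj by blast
  have Rsc: "c *\<^sub>C x \<in> R" if "x \<in> R" for c x
    using that by (auto simp: R_def simp flip: shift_funpow_scaleC)
  have add: "g (x + y) = g x + g y" for x y
    by (rule geq) (use g R(1) in \<open>auto simp: L.add L'.add subspace_add simp del: funpow.simps\<close>)
  have sc: "g (c *\<^sub>C x) = c *\<^sub>C g x" for c x
    by (rule geq) (use g Rsc in \<open>auto simp: shift_funpow_scaleC simp del: funpow.simps\<close>)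
  obtain K where K: "\<And>x. norm ((W ^^ m) x) \<le> norm x * K" using L'.bounded by blast
  have "bounded_linear g"
  proof (rule bounded_linear_intro[where K = "K / c"])
    show "g (r *\<^sub>R x) = r *\<^sub>R g x" for r x using sc[of "complex_of_real r" x] by (simp add: scaleC_of_real)
    show "norm (g x) \<le> norm x * (K / c)" for x
      using c(2)[of "g x"] K[of x] g[of x] c(1) by (simp add: field_simps del: funpow.simps)
  qed (rule add)
  then have G: "blinfun_apply (Blinfun g) = g" by (rule bounded_linear_Blinfun_apply)
  have WR: "W x \<in> R" if "x \<in> R" for x using that by (auto simp: R_def funpow_swap1)
  have comm: "g (W x) = W (g x)" for x
  proof (rule geq, intro conjI WR)
    show "(W ^^ Suc m) (W (g x)) = (W ^^ m) (W x)"
      using g[of x] by (metis funpow_swap1)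
  qed (use g in blast)
  show ?thesis
    unfolding is_drazin_inverse_def
  proof (rule exI[of _ "Blinfun g"], rule exI[of _ m], unfold G, intro conjI allI)
    show "complex_linear (Blinfun g)" by (simp add: complex_linear_def G sc)
    show "g (W (g x)) = g x" for x
      by (rule geq) (simp add: g funpow_swap1)
    show "g (W x) = W (g x)" "(W ^^ Suc m) (g x) = (W ^^ m) x" for x
      using comm g by blast+
  qed
qed

end

section \<open>Complex inner products and the Fredholm alternative\<close>

lemma bounded_bilinear_scaleC: "bounded_bilinear (\<lambda>c x. c *\<^sub>C (x :: 'a::complex_normed_vector))"
proof
  show "(r *\<^sub>R a) *\<^sub>C b = r *\<^sub>R a *\<^sub>C b" for r a and b :: 'a
    by (metis scaleC_of_real scaleC_scaleC scaleR_conv_of_real)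
  show "a *\<^sub>C r *\<^sub>R b = r *\<^sub>R a *\<^sub>C b" for r a and b :: 'a
    by (metis mult.commute scaleC_of_real scaleC_scaleC)
  show "\<exists>K. \<forall>a b. norm (a *\<^sub>C b :: 'a) \<le> norm a * norm b * K"
    by (rule exI[of _ 1]) (simp add: norm_scaleC)
qed (simp_all add: scaleC_add_left scaleC_add_right)

lemmas tendsto_scaleC = bounded_bilinear.tendsto[OF bounded_bilinear_scaleC]

lemma cinner_scaleC_right: "cinner x (c *\<^sub>C y) = cnj c * cinner x y"
  by (metis cinner_commute cinner_scaleC_left complex_cnj_mult)

lemma cinner_add_right: "cinner x (y + z) = cinner x y + cinner x z"
  by (metis cinner_commute cinner_add_left complex_cnj_add)

lemma cinner_minus_left: "cinner (- x) y = - cinner x y"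
  using cinner_scaleC_left[of "-1" x y] by simp

lemma cinner_minus_right: "cinner x (- y) = - cinner x y"
  using cinner_scaleC_right[of x "-1" y] by simp

lemma cinner_diff_left: "cinner (x - y) z = cinner x z - cinner y z"
  using cinner_add_left[of x "- y" z] by (simp add: cinner_minus_left)

lemma cinner_diff_right: "cinner x (y - z) = cinner x y - cinner x z"
  using cinner_add_right[of x y "- z"] by (simp add: cinner_minus_right)

lemma cinner_zero_left [simp]: "cinner 0 x = 0"
  using cinner_diff_left[of 0 0 x] by simp

lemma cinner_zero_right [simp]: "cinner x 0 = 0"
  using cinner_diff_right[of x 0 0] by simp

lemma cinner_self: "cinner x x = complex_of_real ((norm x)\<^sup>2)"
proof -
  have "Im (cinner x x) = 0" using cinner_commute[of x x] by (simp add: complex_eq_iff)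
  then show ?thesis by (simp add: complex_eq_iff Re_cinner power2_norm_eq_inner)
qed

lemma norm_cinner_le: "cmod (cinner x y) \<le> norm x * norm y"
proof (cases "cinner x y = 0")
  case False
  \<comment> \<open>A unimodular phase that makes the inner product real and nonnegative, so that
    the real Cauchy-Schwarz inequality applies.\<close>
  define c where "c = cnj (cinner x y) / cmod (cinner x y)"
  have "cinner (c *\<^sub>C x) y = cmod (cinner x y)"
    using False by (simp add: c_def cinner_scaleC_left mult.commute[of "cnj _"] complex_norm_square[symmetric] power2_eq_square)
  then have "cmod (cinner x y) = inner (c *\<^sub>C x) y"
    by (metis Re_cinner Re_complex_of_real)
  also have "\<dots> \<le> norm (c *\<^sub>C x) * norm y" by (rule norm_cauchy_schwarz)
  also have "norm (c *\<^sub>C x) = norm x" using False by (simp add: c_def norm_scaleC norm_divide)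
  finally show ?thesis .
qed simp

lemma bounded_linear_cinner_left: "bounded_linear (\<lambda>x. cinner x y)"
proof (rule bounded_linear_intro[where K = "norm y"])
  show "cinner (r *\<^sub>R x) y = r *\<^sub>R cinner x y" for r x
    by (simp add: cinner_scaleC_left scaleR_conv_of_real flip: scaleC_of_real)
qed (simp_all add: cinner_add_left norm_cinner_le)

lemma cinner_eq_zeroI: "(\<And>y. cinner x y = 0) \<Longrightarrow> x = 0"
  by (metis cinner_self norm_eq_zero of_real_eq_0_iff power_eq_0_iff)

text \<open>Characteristic values up to sign: for \<open>s \<noteq> 0\<close>, membership means that
  \<open>- 1 / s\<close> is an eigenvalue. The parameter \<open>s\<close> is the coupling variable
  in which poles are counted. The point 0 never belongs to the set.\<close>

definition singular_set :: "('a::complex_normed_vector \<Rightarrow>\<^sub>L 'a) \<Rightarrow> complex set" where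
  "singular_set A = {s. \<exists>x. x \<noteq> 0 \<and> x + s *\<^sub>C A x = 0}"

lemma funpow_eigenvector:
  assumes "complex_linear A" "A x = \<nu> *\<^sub>C x"
  shows "((\<lambda>x. A x - \<mu> *\<^sub>C x) ^^ n) x = (\<nu> - \<mu>) ^ n *\<^sub>C x"
proof (induction n)
  case (Suc n)
  show ?case
    using assms
    by (simp add: Suc complex_linear_scaleC scaleC_scaleC algebra_simps complex_vector.scale_left_diff_distrib)
qed (simp add: scaleC_one)

text \<open>Near 0 the norm of \<open>s A\<close> is below 1. Near \<open>p \<noteq> 0\<close>, an
  eigenvector \<open>x\<close> for an eigenvalue \<open>- 1 / s\<close> other than
  \<open>\<mu> = - 1 / p\<close> satisfies \<open>x = \<nu> s G x\<close>, which forces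
  \<open>cmod (\<nu> s) * norm G \<ge> 1\<close>; but \<open>\<nu> s\<close> tends to 0.\<close>

lemma singular_set_not_islimpt:
  assumes A: "compact_op (A :: 'a::complex_hilbert_space \<Rightarrow>\<^sub>L 'a)"
  shows "\<not> p islimpt singular_set A"
proof -
  have lin: "complex_linear A" using A by (simp add: compact_op_def)
  have "\<forall>\<^sub>F s in at p. s \<notin> singular_set A"
  proof (cases "p = 0")
    case True
    have "((\<lambda>s. cmod s * norm A) \<longlongrightarrow> cmod p * norm A) (at p)" by (intro tendsto_intros)
    then have "\<forall>\<^sub>F s in at p. cmod s * norm A < 1" using True by (rule_tac order_tendstoD) auto
    then show ?thesis
    proof eventually_elim
      case (elim s)
      have "x = 0" if "x + s *\<^sub>C A x = 0" for x
      proof (rule ccontr)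
        assume x: "x \<noteq> 0"
        have "x = - (s *\<^sub>C A x)" using that by (simp add: eq_neg_iff_add_eq_0)
        then have "norm x = cmod s * norm (A x)" by (metis norm_minus_cancel norm_scaleC)
        also have "\<dots> \<le> cmod s * (norm A * norm x)" by (intro mult_left_mono norm_blinfun) auto
        also have "\<dots> < 1 * norm x" using elim x by (simp add: mult.assoc[symmetric])
        finally show False by simp
      qed
      then show ?case unfolding singular_set_def by blast
    qed
  next
    case False
    define \<mu> where "\<mu> = - 1 / p"
    have mu: "\<mu> \<noteq> 0" using False by (simp add: \<mu>_def)
    define W where "W = (\<lambda>x. A x - \<mu> *\<^sub>C x)"
    obtain G m where "is_drazin_inverse W G m"
      using ex_drazin_inverse[OF A mu] unfolding W_def by blast
    note G = is_drazin_inverseD[OF this]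
    define \<nu> where "\<nu> s = - 1 / s - \<mu>" for s
    have "((\<lambda>s. cmod (\<nu> s) * norm G) \<longlongrightarrow> cmod (\<nu> p) * norm G) (at p)"
      unfolding \<nu>_def by (intro tendsto_intros False)
    then have "\<forall>\<^sub>F s in at p. cmod (\<nu> s) * norm G < 1"
      by (rule order_tendstoD) (simp add: \<nu>_def \<mu>_def)
    moreover have "\<forall>\<^sub>F s in at p. s \<noteq> 0" using False by (rule tendsto_imp_eventually_ne[OF tendsto_ident_at])
    moreover have "\<forall>\<^sub>F s in at p. s \<noteq> p" by (simp add: eventually_at_filter)
    ultimately show ?thesis
    proof eventually_elim
      case (elim s)
      have nu: "\<nu> s \<noteq> 0" using elim(2,3) False by (simp add: \<nu>_def \<mu>_def field_simps)
      have "x = 0" if x: "x + s *\<^sub>C A x = 0" for x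
      proof (rule ccontr)
        assume x0: "x \<noteq> 0"
        have "(1 / s) *\<^sub>C (s *\<^sub>C A x) = (1 / s) *\<^sub>C (- x)" using x by (simp add: add_eq_0_iff)
        then have Ax: "A x = (- 1 / s) *\<^sub>C x" using elim(2) by (simp add: scaleC_scaleC scaleC_one)
        have "A (G x) = G (A x)"
          using G(2)[of x] by (simp add: W_def blinfun.diff_right complex_linear_scaleC[OF G(1)])
        also have "\<dots> = (- 1 / s) *\<^sub>C G x"
          unfolding Ax by (rule complex_linear_scaleC[OF G(1)])
        finally have AG: "A (G x) = (- 1 / s) *\<^sub>C G x" .
        \<comment> \<open>\<open>G\<close> commutes with \<open>A\<close>, so \<open>G x\<close>
          belongs to the same eigenvalue and the last Drazin identity becomes a scalar
          relation.\<close>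
        have "\<nu> s ^ Suc m *\<^sub>C G x = \<nu> s ^ m *\<^sub>C x"
          using G(4)[of x]
          unfolding W_def funpow_eigenvector[OF lin Ax] funpow_eigenvector[OF lin AG] \<nu>_def[symmetric] .
        then have "\<nu> s ^ m *\<^sub>C \<nu> s *\<^sub>C G x = \<nu> s ^ m *\<^sub>C x"
          by (simp only: power_Suc2 scaleC_scaleC)
        then have "\<nu> s *\<^sub>C G x = x"
          by (rule complex_vector.scale_left_imp_eq[rotated]) (use nu in simp)
        then have "norm x = cmod (\<nu> s) * norm (G x)" by (metis norm_scaleC)
        also have "\<dots> \<le> cmod (\<nu> s) * (norm G * norm x)" by (intro mult_left_mono norm_blinfun) auto
        also have "\<dots> < 1 * norm x" using elim(1) x0 by (simp add: mult.assoc[symmetric])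
        finally show False by simp
      qed
      then show ?case unfolding singular_set_def by blast
    qed
  qed
  then show ?thesis by (simp add: islimpt_iff_eventually)
qed

lemma complex_linear_compose: "complex_linear A \<Longrightarrow> complex_linear B \<Longrightarrow> complex_linear (A o\<^sub>L B)"
  by (simp add: complex_linear_def)

text \<open>Injectivity of 1 + s A makes all powers of \<open>W\<close> injective. Then W^m cancels
  from W^(m+1) G = W^m, so the Drazin inverse is a true inverse and surjectivity follows. The factor
  1/s accounts for 1 + s A = s W.\<close>

lemma fredholm_inverse:
  assumes A: "compact_op (A :: 'a::complex_hilbert_space \<Rightarrow>\<^sub>L 'a)" and s: "s \<notin> singular_set A"
  obtains N where "complex_linear N" "\<And>x. blinfun_apply N (x + s *\<^sub>C A x) = x" "\<And>x. N x + s *\<^sub>C A (N x) = x"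
proof (cases "s = 0")
  case True
  then show ?thesis by (intro that[of id_blinfun]) (simp_all add: complex_linear_def)
next
  case False
  define \<mu> where "\<mu> = - 1 / s"
  define W where "W = (\<lambda>x. A x - \<mu> *\<^sub>C x)"
  have mu: "\<mu> \<noteq> 0" using False by (simp add: \<mu>_def)
  obtain G m where "is_drazin_inverse W G m"
    using ex_drazin_inverse[OF A mu] unfolding W_def by blast
  note G = is_drazin_inverseD[OF this]
  have sW: "s *\<^sub>C W x = x + s *\<^sub>C A x" for x
    using False by (simp add: W_def \<mu>_def scaleC_add_right scaleC_scaleC scaleC_one add.commute)
  have W0: "x = 0" if "W x = 0" for x
  proof -
    have "x + s *\<^sub>C A x = 0" unfolding sW[symmetric] that by simp
    then show ?thesis using s unfolding singular_set_def by blast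
  qed
  have Wn0: "x = 0" if "(W ^^ n) x = 0" for n x
    using that by (induction n) (use W0 in auto)
  interpret L: bounded_linear "W ^^ m" unfolding W_def by (rule shift_funpow[OF A mu])
  have WG: "W (G x) = x" for x
  proof -
    have "(W ^^ m) (W (G x) - x) = 0" using G(4)[of x] by (simp add: L.diff funpow_swap1)
    then show ?thesis using Wn0 by fastforce
  qed
  show ?thesis
  proof (rule that[of "(1 / s) *\<^sub>C G"])
    show "complex_linear ((1 / s) *\<^sub>C G)"
      using G(1) by (simp add: complex_linear_def blinfun_apply_scaleC scaleC_scaleC mult.commute)
    show "((1 / s) *\<^sub>C G) (x + s *\<^sub>C A x) = x" for x
      using False by (simp add: sW[symmetric] blinfun_apply_scaleC complex_linear_scaleC[OF G(1)] scaleC_scaleC scaleC_one G(2) WG)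
    have lin: "complex_linear A" using A by (simp add: compact_op_def)
    show "((1 / s) *\<^sub>C G) x + s *\<^sub>C A (((1 / s) *\<^sub>C G) x) = x" for x
    proof -
      have "W ((1 / s) *\<^sub>C G x) = (1 / s) *\<^sub>C W (G x)"
        unfolding W_def complex_linear_scaleC[OF lin] complex_vector.scale_right_diff_distrib scaleC_scaleC
        by (simp add: mult.commute)
      then show ?thesis
        using False by (simp add: blinfun_apply_scaleC sW[symmetric] WG scaleC_scaleC scaleC_one)
    qed
  qed
qed

section \<open>Meromorphic continuation\<close>

text \<open>\<open>M s\<close> is A (1 + s A)^-1. It is handled through two one-sided equations, the
  first of which can also be verified for an arbitrary meromorphic extension, where no inverse is at
  hand.\<close>

lemma meromorphic_family:
  assumes A: "compact_op (A :: 'a::complex_hilbert_space \<Rightarrow>\<^sub>L 'a)"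
  obtains M where "\<And>s. s \<notin> singular_set A \<Longrightarrow> complex_linear (M s)"
    "\<And>s x. s \<notin> singular_set A \<Longrightarrow> blinfun_apply (M s) (x + s *\<^sub>C A x) = A x"
    "\<And>s x. s \<notin> singular_set A \<Longrightarrow> M s x + s *\<^sub>C A (M s x) = A x"
proof -
  have "\<exists>M. complex_linear M \<and> (\<forall>x. blinfun_apply M (x + s *\<^sub>C A x) = A x) \<and> (\<forall>x. M x + s *\<^sub>C A (M x) = A x)"
    if s: "s \<notin> singular_set A" for s
  proof -
    obtain N where N: "complex_linear N" "\<And>x. blinfun_apply N (x + s *\<^sub>C A x) = x" "\<And>x. N x + s *\<^sub>C A (N x) = x"
      using fredholm_inverse[OF A s] by blast
    have lin: "complex_linear A" using A by (simp add: compact_op_def)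
    have "A (N x) + s *\<^sub>C A (A (N x)) = A x" for x
      using arg_cong[OF N(3)[of x], of "blinfun_apply A"]
      by (simp add: blinfun.add_right complex_linear_scaleC[OF lin])
    then show ?thesis
      by (intro exI[of _ "A o\<^sub>L N"]) (simp add: complex_linear_compose lin N)
  qed
  then obtain M where "\<And>s. s \<notin> singular_set A \<Longrightarrow> complex_linear (M s)
      \<and> (\<forall>x. blinfun_apply (M s) (x + s *\<^sub>C A x) = A x) \<and> (\<forall>x. M s x + s *\<^sub>C A (M s x) = A x)"
    by metis
  then show ?thesis using that by blast
qed

text \<open>First resolvent identity for A (1 + s A)^-1. The left equation at \<open>s\<close> and
  the right equation at \<open>t\<close> express both \<open>M x\<close> and \<open>M' x\<close>
  through \<open>A x\<close>, \<open>M (M' x)\<close> and \<open>M (A (M' x))\<close>, and the last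
  of these enters both with the same coefficient.\<close>

lemma meromorphic_family_difference:
  assumes "complex_linear A" "complex_linear M"
    and M: "\<And>x. blinfun_apply M (x + s *\<^sub>C A x) = A x" and M': "\<And>x. M' x + t *\<^sub>C A (M' x) = A x"
  shows "M x - M' x = (t - s) *\<^sub>C M (M' x)"
proof -
  have M_add: "M v = A v - s *\<^sub>C M (A v)" for v
    using M[of v] by (simp add: blinfun.add_right complex_linear_scaleC[OF assms(2)] eq_diff_eq)
  have M'x: "M' x = A x - t *\<^sub>C A (M' x)" using M'[of x] by (simp add: eq_diff_eq)
  have "M (A x) = M (M' x) + t *\<^sub>C M (A (M' x))"
    using arg_cong[OF M'[of x], of "blinfun_apply M"]
    by (simp add: blinfun.add_right complex_linear_scaleC[OF assms(2)])
  then have Mx: "M x = A x - s *\<^sub>C M (M' x) - (s * t) *\<^sub>C M (A (M' x))"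
    using M_add[of x] by (simp add: scaleC_add_right)
  have M'x2: "M' x = A x - t *\<^sub>C M (M' x) - (t * s) *\<^sub>C M (A (M' x))"
  proof -
    have "A (M' x) = M (M' x) + s *\<^sub>C M (A (M' x))"
      using M[of "M' x"] by (simp add: blinfun.add_right complex_linear_scaleC[OF assms(2)])
    then have "t *\<^sub>C A (M' x) = t *\<^sub>C M (M' x) + (t * s) *\<^sub>C M (A (M' x))"
      by (metis scaleC_add_right scaleC_scaleC)
    with M'x show ?thesis by (metis diff_diff_eq)
  qed
  define u where "u = M (M' x)"
  define w where "w = M (A (M' x))"
  show ?thesis
    using Mx M'x2 unfolding u_def[symmetric] w_def[symmetric]
    by (simp add: complex_vector.scale_left_diff_distrib mult.commute)
qed

lemma norm_scaleC_blinfun_compose_le: "norm (c *\<^sub>C (L o\<^sub>L N)) \<le> cmod c * norm L * norm N"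
  unfolding norm_scaleC mult.assoc by (intro mult_left_mono norm_blinfun_compose) simp

text \<open>The unknown \<open>M s\<close> also stands on the right of the identity. Once
  \<open>cmod (t - s) * norm (M t) < 1 / 2\<close> it is absorbed on the left, giving
  \<open>norm (M s) \<le> 2 * norm (M t)\<close>; then the right side tends to 0.\<close>

lemma meromorphic_family_continuous:
  assumes diff: "\<And>s x. s \<in> S \<Longrightarrow> blinfun_apply (M s) x - M t x = (t - s) *\<^sub>C M s (M t x)"
  shows "(M \<longlongrightarrow> M t) (at t within S)"
proof -
  have D: "M s - M t = (t - s) *\<^sub>C (M s o\<^sub>L M t)" if "s \<in> S" for s
    by (rule blinfun_eqI) (simp add: blinfun.diff_left blinfun_apply_scaleC diff[OF that])
  have lim: "((\<lambda>s. cmod (t - s) * norm (M t)) \<longlongrightarrow> cmod (t - t) * norm (M t)) (at t within S)"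
    by (intro tendsto_intros)
  have S: "\<forall>\<^sub>F s in at t within S. s \<in> S" by (simp add: eventually_at_filter)
  have "\<forall>\<^sub>F s in at t within S. cmod (t - s) * norm (M t) < 1 / 2"
    by (rule order_tendstoD(2)[OF lim]) simp
  with S have "\<forall>\<^sub>F s in at t within S. norm (M s - M t) \<le> 2 * norm (M t) * (cmod (t - s) * norm (M t))"
  proof eventually_elim
    case (elim s)
    have le: "norm (M s - M t) \<le> cmod (t - s) * norm (M s) * norm (M t)"
      unfolding D[OF elim(1)] by (rule norm_scaleC_blinfun_compose_le)
    also have "\<dots> = norm (M s) * (cmod (t - s) * norm (M t))" by simp
    also have "\<dots> \<le> norm (M s) * (1 / 2)" using elim(2) by (intro mult_left_mono) auto
    finally have "norm (M s) \<le> 2 * norm (M t)"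
      using norm_triangle_sub[of "M s" "M t"] by linarith
    then have "norm (M s) * (cmod (t - s) * norm (M t)) \<le> 2 * norm (M t) * (cmod (t - s) * norm (M t))"
      by (intro mult_right_mono) auto
    with le show ?case by (simp add: mult_ac)
  qed
  moreover have "((\<lambda>s. 2 * norm (M t) * (cmod (t - s) * norm (M t))) \<longlongrightarrow> 2 * norm (M t) * (cmod (t - t) * norm (M t))) (at t within S)"
    by (intro tendsto_intros)
  ultimately have "((\<lambda>s. M s - M t) \<longlongrightarrow> 0) (at t within S)"
    using Lim_null_comparison[of "\<lambda>s. M s - M t" "\<lambda>s. 2 * norm (M t) * (cmod (t - s) * norm (M t))"]
    by simp
  then show ?thesis by (simp add: LIM_zero_iff)
qed

lemma meromorphic_family_holomorphic:
  assumes diff: "\<And>s t x. s \<in> S \<Longrightarrow> t \<in> S \<Longrightarrow> blinfun_apply (M s) x - M t x = (t - s) *\<^sub>C M s (M t x)"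
  shows "norm_holomorphic_on M S"
  unfolding norm_holomorphic_on_def
proof (intro ballI exI)
  fix t assume t: "t \<in> S"
  \<comment> \<open>The limit of the difference quotient in \<open>diff\<close>. The remainder is (t
    - s) (M s - M t) M t, which is small by continuity.\<close>
  define D where "D = - (M t o\<^sub>L M t)"
  have bl: "bounded_linear (\<lambda>h. h *\<^sub>C D)"
    by (rule bounded_bilinear.bounded_linear_left[OF bounded_bilinear_scaleC])
  have R: "M s - M t - (s - t) *\<^sub>C D = (t - s) *\<^sub>C ((M s - M t) o\<^sub>L M t)" if "s \<in> S" for s
  proof (rule blinfun_eqI)
    fix x
    have "(M s - M t - (s - t) *\<^sub>C D) x = (t - s) *\<^sub>C M s (M t x) - (t - s) *\<^sub>C M t (M t x)"
      using diff[OF that t, of x]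
      by (simp add: D_def blinfun.diff_left blinfun.minus_left blinfun_apply_scaleC
          complex_vector.scale_left_diff_distrib)
    then show "(M s - M t - (s - t) *\<^sub>C D) x = ((t - s) *\<^sub>C ((M s - M t) o\<^sub>L M t)) x"
      by (simp only: blinfun_apply_scaleC blinfun_apply_blinfun_compose blinfun.diff_left
          complex_vector.scale_right_diff_distrib)
  qed
  have "((\<lambda>s. norm (M s - M t) * norm (M t)) \<longlongrightarrow> norm (M t - M t) * norm (M t)) (at t within S)"
    by (intro tendsto_intros meromorphic_family_continuous diff t)
  then have "((\<lambda>s. norm (M s - M t) * norm (M t)) \<longlongrightarrow> 0) (at t within S)" by simp
  moreover have "\<forall>\<^sub>F s in at t within S. norm ((M s - M t - (s - t) *\<^sub>C D) /\<^sub>R norm (s - t)) \<le> norm (M s - M t) * norm (M t)"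
  proof -
    have "\<forall>\<^sub>F s in at t within S. s \<in> S \<and> s \<noteq> t" by (simp add: eventually_at_filter)
    then show ?thesis
    proof eventually_elim
      case (elim s)
      have "norm ((M s - M t - (s - t) *\<^sub>C D) /\<^sub>R norm (s - t)) = norm ((t - s) *\<^sub>C ((M s - M t) o\<^sub>L M t)) / cmod (t - s)"
        using elim R[of s] by (simp add: norm_minus_commute divide_inverse mult.commute)
      also have "\<dots> \<le> cmod (t - s) * norm (M s - M t) * norm (M t) / cmod (t - s)"
        by (intro divide_right_mono norm_scaleC_blinfun_compose_le) simp
      also have "\<dots> = norm (M s - M t) * norm (M t)" using elim by simp
      finally show ?case .
    qed
  qed
  ultimately have "((\<lambda>s. (M s - M t - (s - t) *\<^sub>C D) /\<^sub>R norm (s - t)) \<longlongrightarrow> 0) (at t within S)"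
    by (rule Lim_null_comparison[rotated])
  then show "(M has_derivative (\<lambda>h. h *\<^sub>C D)) (at t within S)"
    by (simp add: has_derivative_within bl divide_inverse diff_diff_eq)
qed

text \<open>For real \<open>w\<close> this is \<open>id\<close>. Matrix elements are holomorphic off
  \<open>S\<close>, and removing a set without limit points leaves the plane connected, so the
  identity theorem carries the relation to all other \<open>w\<close>.\<close>

lemma meromorphic_extension_identity:
  fixes A :: "real \<Rightarrow> ('a::complex_hilbert_space \<Rightarrow>\<^sub>L 'a)"
  assumes ext: "meromorphic_extension A M S" and id: "\<And>s x. A s (x + complex_of_real s *\<^sub>C A 0 x) = A 0 x"
    and w: "w \<notin> S"
  shows "M w (x + w *\<^sub>C A 0 x) = A 0 x"
proof -
  have S: "\<And>p. \<not> p islimpt S" and hol: "norm_holomorphic_on M (- S)"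
    and lin: "\<And>s. s \<notin> S \<Longrightarrow> complex_linear (M s)"
    and real: "\<And>s. complex_of_real s \<notin> S" "\<And>s. M (complex_of_real s) = A s"
    using ext by (auto simp: meromorphic_extension_def)
  have sp: "S sparse_in UNIV" by (simp add: sparse_in_open S)
  have op: "open (- S)" using open_diff_sparse_pts[OF open_UNIV sp] by (simp add: Compl_eq_Diff_UNIV)
  have con: "connected (- S)"
    using sparse_imp_connected[OF _ connected_UNIV open_UNIV sp] by (simp add: Compl_eq_Diff_UNIV)
  have holv: "(\<lambda>s. cinner (M s v) y) holomorphic_on (- S)" for v y
    unfolding holomorphic_on_def field_differentiable_def
  proof
    fix s assume "s \<in> - S"
    then obtain D where D: "(M has_derivative (\<lambda>h. h *\<^sub>C D)) (at s within - S)"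
      using hol by (auto simp: norm_holomorphic_on_def)
    have bl: "bounded_linear (\<lambda>L. cinner (blinfun_apply L v) y)"
      by (rule bounded_linear_compose[OF bounded_linear_cinner_left blinfun.bounded_linear_left])
    have "((\<lambda>s. cinner (M s v) y) has_derivative (\<lambda>h. cinner (blinfun_apply (h *\<^sub>C D) v) y)) (at s within - S)"
      by (rule bounded_linear.has_derivative[OF bl D])
    then have "((\<lambda>s. cinner (M s v) y) has_field_derivative cinner (D v) y) (at s within - S)"
      by (rule has_derivative_imp_has_field_derivative)
         (simp add: blinfun_apply_scaleC cinner_scaleC_left mult.commute)
    then show "\<exists>f'. ((\<lambda>s. cinner (M s v) y) has_field_derivative f') (at s within - S)" ..
  qed
  have "cinner (M w (x + w *\<^sub>C A 0 x) - A 0 x) y = 0" for y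
  proof -
    define g where "g s = cinner (M s x) y + s * cinner (M s (A 0 x)) y - cinner (A 0 x) y" for s
    have geq: "cinner (M s (x + s *\<^sub>C A 0 x) - A 0 x) y = g s" if "s \<notin> S" for s
      by (simp add: g_def blinfun.add_right complex_linear_scaleC[OF lin[OF that]] cinner_add_left
          cinner_diff_left cinner_scaleC_left)
    have "g w = 0"
    proof (rule analytic_continuation[where f = g and S = "- S" and U = "range complex_of_real" and \<xi> = 0])
      show "g holomorphic_on - S" unfolding g_def by (intro holomorphic_intros holv)
      show "0 \<in> - S" using real(1)[of 0] by simp
      show "range complex_of_real \<subseteq> - S" using real(1) by auto
      show "0 islimpt range complex_of_real"
        unfolding islimpt_approachable
      proof (intro allI impI)
        fix e :: real assume "0 < e"
        then show "\<exists>x'\<in>range complex_of_real. x' \<noteq> 0 \<and> dist x' 0 < e"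
          by (intro bexI[OF _ rangeI[of _ "e / 2"]]) (auto simp: norm_divide)
      qed
      show "g z = 0" if "z \<in> range complex_of_real" for z
      proof -
        from that obtain s where "z = complex_of_real s" by blast
        then show ?thesis using geq[of z] real id[of s x] by simp
      qed
    qed (use op con w in auto)
    with geq[OF w] show ?thesis by simp
  qed
  then show ?thesis by (metis cinner_eq_zeroI eq_iff_diff_eq_0)
qed

text \<open>If \<open>1 + r A\<close> had an inverse \<open>N\<close>, then with
  \<open>C = A N\<close> the relation would read \<open>M s = C - (s - r) M s C\<close>. Absorbing
  the last term bounds \<open>M s\<close> near \<open>r\<close>, so (s - r)^n M s tends to 0 instead
  of \<open>L\<close>.\<close>

lemma pole_in_singular_set:
  fixes A :: "'a::complex_hilbert_space \<Rightarrow>\<^sub>L 'a"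
  assumes A: "compact_op A" and M: "\<And>s x. s \<notin> S \<Longrightarrow> blinfun_apply (M s) (x + s *\<^sub>C A x) = A x"
    and lin: "\<And>s. s \<notin> S \<Longrightarrow> complex_linear (M s)"
    and S: "\<not> r islimpt S" and n: "n > 0" and L: "L \<noteq> 0" "((\<lambda>s. (s - r) ^ n *\<^sub>C M s) \<longlongrightarrow> L) (at r)"
  shows "r \<in> singular_set A"
proof (rule ccontr)
  assume "r \<notin> singular_set A"
  then obtain N where N: "\<And>x. blinfun_apply N (x + r *\<^sub>C A x) = x" "\<And>x. N x + r *\<^sub>C A (N x) = x"
    using fredholm_inverse[OF A] by metis
  let ?C = "A o\<^sub>L N"
  have Meq: "M s = ?C - (s - r) *\<^sub>C (M s o\<^sub>L ?C)" if s: "s \<notin> S" for s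
  proof (rule blinfun_eqI)
    fix x
    have "x + (s - r) *\<^sub>C A (N x) = N x + s *\<^sub>C A (N x)"
      using N(2)[of x] by (simp add: complex_vector.scale_left_diff_distrib algebra_simps)
    then have "M s (x + (s - r) *\<^sub>C A (N x)) = A (N x)" using M[OF s] by simp
    then show "M s x = (?C - (s - r) *\<^sub>C (M s o\<^sub>L ?C)) x"
      by (simp add: blinfun.add_right blinfun.diff_left blinfun_apply_scaleC complex_linear_scaleC[OF lin[OF s]] eq_diff_eq)
  qed
  have ev: "\<forall>\<^sub>F s in at r. s \<notin> S" using S by (simp add: islimpt_iff_eventually)
  have "((\<lambda>s. cmod (s - r) * norm ?C) \<longlongrightarrow> cmod (r - r) * norm ?C) (at r)"
    by (intro tendsto_intros)
  then have "\<forall>\<^sub>F s in at r. cmod (s - r) * norm ?C < 1 / 2"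
    by (rule order_tendstoD(2)) simp
  with ev have "\<forall>\<^sub>F s in at r. norm ((s - r) ^ n *\<^sub>C M s) \<le> cmod (s - r) ^ n * (2 * norm ?C)"
  proof eventually_elim
    case (elim s)
    have "norm (M s) \<le> norm ?C + norm ((s - r) *\<^sub>C (M s o\<^sub>L ?C))"
      by (subst Meq[OF elim(1)]) (rule norm_triangle_ineq4)
    also have "norm ((s - r) *\<^sub>C (M s o\<^sub>L ?C)) \<le> cmod (s - r) * norm (M s) * norm ?C"
      by (rule norm_scaleC_blinfun_compose_le)
    also have "\<dots> = norm (M s) * (cmod (s - r) * norm ?C)" by simp
    also have "\<dots> \<le> norm (M s) * (1 / 2)" using elim(2) by (intro mult_left_mono) auto
    finally have "norm (M s) \<le> 2 * norm ?C" by simp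
    then show ?case by (simp add: norm_scaleC norm_power mult_left_mono)
  qed
  moreover have "((\<lambda>s. cmod (s - r) ^ n * (2 * norm ?C)) \<longlongrightarrow> cmod (r - r) ^ n * (2 * norm ?C)) (at r)"
    by (intro tendsto_intros)
  ultimately have "((\<lambda>s. (s - r) ^ n *\<^sub>C M s) \<longlongrightarrow> 0) (at r)"
    using Lim_null_comparison[of "\<lambda>s. (s - r) ^ n *\<^sub>C M s" "\<lambda>s. cmod (s - r) ^ n * (2 * norm ?C)"] n
    by (simp add: power_0_left)
  with L show False using tendsto_unique[OF trivial_limit_at] by metis
qed

text \<open>With \<open>\<mu> = - 1 / p\<close>, \<open>W = A - \<mu>\<close> and \<open>\<Pi> = 1 - W G\<close> the Riesz projection, the product \<open>M s W G\<close> stays bounded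
  near \<open>p\<close>, and the last non-zero \<open>W\<^sup>j \<Pi>\<close> gives the leading Laurent coefficient of \<open>M s \<Pi>\<close>. The natural local
  variable is \<open>\<nu> = - 1 / s - \<mu>\<close>, since \<open>1 + s A = s (W - \<nu>)\<close>.\<close>

lemma singular_set_pole:
  assumes A: "compact_op (A :: 'a::complex_hilbert_space \<Rightarrow>\<^sub>L 'a)" and p: "p \<in> singular_set A"
    and lin_M: "\<And>s. s \<notin> singular_set A \<Longrightarrow> complex_linear (M s)"
    and M: "\<And>s x. s \<notin> singular_set A \<Longrightarrow> blinfun_apply (M s) (x + s *\<^sub>C A x) = A x"
  shows "\<exists>n>0. \<exists>L. L \<noteq> 0 \<and> ((\<lambda>s. (s - p) ^ n *\<^sub>C M s) \<longlongrightarrow> L) (at p)"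
proof -
  have lin: "complex_linear A" using A by (simp add: compact_op_def)
  obtain x0 where x0: "x0 \<noteq> 0" "x0 + p *\<^sub>C A x0 = 0" using p unfolding singular_set_def by blast
  have p0: "p \<noteq> 0" using x0 by auto
  define \<mu> where "\<mu> = - 1 / p"
  have mu: "\<mu> \<noteq> 0" using p0 by (simp add: \<mu>_def)
  define W where "W = (\<lambda>x. A x - \<mu> *\<^sub>C x)"
  define Wb where "Wb = A - \<mu> *\<^sub>C id_blinfun"
  have Wb: "Wb x = W x" for x by (simp add: Wb_def W_def blinfun.diff_left blinfun_apply_scaleC)
  obtain G m where "is_drazin_inverse W G m"
    using ex_drazin_inverse[OF A mu] unfolding W_def by blast
  note G = is_drazin_inverseD[OF this]
  define Q where "Q k = ((\<lambda>L. Wb o\<^sub>L L) ^^ k) (id_blinfun - (Wb o\<^sub>L G))" for k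
  have Q_Suc: "Q (Suc k) = Wb o\<^sub>L Q k" for k by (simp add: Q_def)
  have Q_apply: "Q k x = (W ^^ k) (x - W (G x))" for k x
  proof (induction k)
    case 0
    have "Q 0 = id_blinfun - (Wb o\<^sub>L G)" by (simp add: Q_def)
    then show ?case by (simp add: blinfun.diff_left Wb)
  qed (simp add: Q_Suc Wb)
  interpret Wm: bounded_linear "W ^^ m" unfolding W_def by (rule shift_funpow[OF A mu])
  have "Q m = 0"
    by (rule blinfun_eqI) (use G(4) in \<open>simp add: Q_apply Wm.diff funpow_swap1\<close>)
  moreover have "Q 0 \<noteq> 0"
  proof
    assume "Q 0 = 0"
    have "p *\<^sub>C A x0 = - x0" using x0(2) by (simp add: add_eq_0_iff)
    then have "(1 / p) *\<^sub>C p *\<^sub>C A x0 = (1 / p) *\<^sub>C (- x0)" by (simp only:)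
    then have "A x0 = \<mu> *\<^sub>C x0" using p0 by (simp add: \<mu>_def)
    then have "W x0 = 0" by (simp add: W_def)
    then have "W (G x0) = 0" using G(2)[of x0] by (simp add: blinfun.zero_right)
    then have "Q 0 x0 = x0" by (simp add: Q_apply)
    with \<open>Q 0 = 0\<close> x0(1) show False by simp
  qed
  ultimately have "\<exists>k<m. (\<forall>i\<le>k. Q i \<noteq> 0) \<and> Q (Suc k) = 0"
    by (rule ex_least_nat_less)
  then obtain j where j: "Q j \<noteq> 0" "Q (Suc j) = 0" by blast
  have AQ: "A o\<^sub>L Q j = \<mu> *\<^sub>C Q j"
  proof (rule blinfun_eqI)
    fix x
    have "W (Q j x) = 0" using j(2) by (metis Q_Suc Wb blinfun_apply_blinfun_compose zero_blinfun.rep_eq)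
    then show "(A o\<^sub>L Q j) x = (\<mu> *\<^sub>C Q j) x" by (simp add: W_def blinfun_apply_scaleC)
  qed
  define \<nu> where "\<nu> s = - 1 / s - \<mu>" for s
  have ev: "\<forall>\<^sub>F s in at p. s \<notin> singular_set A" "\<forall>\<^sub>F s in at p. s \<noteq> 0"
    using singular_set_not_islimpt[OF A] tendsto_imp_eventually_ne[OF tendsto_ident_at p0]
    by (auto simp: islimpt_iff_eventually)
  have nu_lim: "(\<nu> \<longlongrightarrow> 0) (at p)"
  proof -
    have "((\<lambda>s. - 1 / s - \<mu>) \<longlongrightarrow> - 1 / p - \<mu>) (at p)" by (intro tendsto_intros p0)
    then show ?thesis by (simp add: \<nu>_def[abs_def] \<mu>_def)
  qed
  have key: "\<nu> s *\<^sub>C M s v = M s (W v) - (1 / s) *\<^sub>C A v" if s: "s \<notin> singular_set A" "s \<noteq> 0" for s v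
  proof -
    have "A v = M s v + s *\<^sub>C M s (A v)"
      using M[OF s(1), of v] by (simp add: blinfun.add_right complex_linear_scaleC[OF lin_M[OF s(1)]])
    then have "(1 / s) *\<^sub>C A v = (1 / s) *\<^sub>C M s v + (1 / s) *\<^sub>C s *\<^sub>C M s (A v)"
      by (metis scaleC_add_right)
    then have "(1 / s) *\<^sub>C A v = (1 / s) *\<^sub>C M s v + M s (A v)"
      using s(2) by simp
    moreover have "M s (W v) = M s (A v) - \<mu> *\<^sub>C M s v"
      by (simp add: W_def blinfun.diff_right complex_linear_scaleC[OF lin_M[OF s(1)]])
    ultimately show ?thesis
      by (simp add: \<nu>_def complex_vector.scale_left_diff_distrib)
  qed
  have key_Q: "\<nu> s *\<^sub>C (M s o\<^sub>L Q k) = (M s o\<^sub>L Q (Suc k)) - (1 / s) *\<^sub>C (A o\<^sub>L Q k)"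
    if s: "s \<notin> singular_set A" "s \<noteq> 0" for s k
    by (rule blinfun_eqI) (simp add: blinfun_apply_scaleC blinfun.diff_left key[OF s] Q_Suc Wb)
  \<comment> \<open>At stage \<open>i = 0\<close> the limit is \<open>- \<mu> / p\<close> times
    \<open>Q j\<close>, and \<open>- 1 / p = \<mu>\<close>.\<close>
  define L where "L = (\<mu> * \<mu>) *\<^sub>C Q j"
  have L0: "L \<noteq> 0" using mu j(1) by (simp add: L_def)
  have inv_lim: "((\<lambda>s. 1 / s) \<longlongrightarrow> 1 / p) (at p)" by (intro tendsto_intros p0)
  \<comment> \<open>Recursion down to \<open>Q 0\<close>: multiplying \<open>key_Q\<close> by
    \<nu>^(i+1) lowers the index by one, and the correction vanishes because \<nu> tends to 0. All
    stages therefore share the limit \<open>L\<close>.\<close>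
  have lim_Q: "((\<lambda>s. \<nu> s ^ Suc i *\<^sub>C (M s o\<^sub>L Q (j - i))) \<longlongrightarrow> L) (at p)" if "i \<le> j" for i
    using that
  proof (induction i)
    case 0
    have "((\<lambda>s. - ((1 / s) *\<^sub>C (\<mu> *\<^sub>C Q j))) \<longlongrightarrow> - ((1 / p) *\<^sub>C (\<mu> *\<^sub>C Q j))) (at p)"
      by (intro tendsto_minus tendsto_scaleC inv_lim tendsto_const)
    moreover have "- ((1 / p) *\<^sub>C (\<mu> *\<^sub>C Q j)) = L"
      by (simp add: L_def \<mu>_def)
    moreover have "\<forall>\<^sub>F s in at p. - ((1 / s) *\<^sub>C (\<mu> *\<^sub>C Q j)) = \<nu> s ^ Suc 0 *\<^sub>C (M s o\<^sub>L Q (j - 0))"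
      using ev
    proof eventually_elim
      case (elim s)
      then show ?case using key_Q[OF elim, of j] by (simp add: j(2) AQ)
    qed
    ultimately show ?case by (simp add: Lim_transform_eventually)
  next
    case (Suc i)
    have Sj: "Suc (j - Suc i) = j - i" using Suc.prems by simp
    have "((\<lambda>s. \<nu> s ^ Suc i *\<^sub>C (M s o\<^sub>L Q (j - i)) - \<nu> s ^ Suc i *\<^sub>C (1 / s) *\<^sub>C (A o\<^sub>L Q (j - Suc i)))
        \<longlongrightarrow> L - 0 ^ Suc i *\<^sub>C (1 / p) *\<^sub>C (A o\<^sub>L Q (j - Suc i))) (at p)"
      using Suc by (intro tendsto_diff tendsto_scaleC tendsto_power nu_lim inv_lim tendsto_const) auto
    moreover have "\<forall>\<^sub>F s in at p. \<nu> s ^ Suc i *\<^sub>C (M s o\<^sub>L Q (j - i)) - \<nu> s ^ Suc i *\<^sub>C (1 / s) *\<^sub>C (A o\<^sub>L Q (j - Suc i))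
        = \<nu> s ^ Suc (Suc i) *\<^sub>C (M s o\<^sub>L Q (j - Suc i))"
      using ev
    proof eventually_elim
      case (elim s)
      have "\<nu> s ^ Suc (Suc i) *\<^sub>C (M s o\<^sub>L Q (j - Suc i)) = \<nu> s ^ Suc i *\<^sub>C \<nu> s *\<^sub>C (M s o\<^sub>L Q (j - Suc i))"
        by (metis power_Suc2 scaleC_scaleC)
      then show ?case
        unfolding key_Q[OF elim] Sj complex_vector.scale_right_diff_distrib by simp
    qed
    ultimately show ?case by (simp add: Lim_transform_eventually del: power_Suc)
  qed
  define Z where "Z s = M s o\<^sub>L (Wb o\<^sub>L G)" for s
  \<comment> \<open>This is \<open>key\<close> at \<open>v = G x\<close>, using
    \<open>W (G (G x)) = G x\<close>. As \<nu> tends to 0, absorbing the last term bounds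
    \<open>Z\<close> near \<open>p\<close>.\<close>
  have Z_eq: "Z s = (1 / s) *\<^sub>C (A o\<^sub>L G) + \<nu> s *\<^sub>C (Z s o\<^sub>L G)" if s: "s \<notin> singular_set A" "s \<noteq> 0" for s
  proof (rule blinfun_eqI)
    fix x
    have "W (G (G x)) = G x" using G(2)[of "G x"] G(3)[of x] by simp
    then show "Z s x = ((1 / s) *\<^sub>C (A o\<^sub>L G) + \<nu> s *\<^sub>C (Z s o\<^sub>L G)) x"
      using key[OF s, of "G x"]
      by (simp add: Z_def Wb blinfun.add_left blinfun_apply_scaleC)
  qed
  have "((\<lambda>s. cmod (\<nu> s) * norm G) \<longlongrightarrow> cmod 0 * norm G) (at p)"
    by (intro tendsto_intros nu_lim)
  then have "\<forall>\<^sub>F s in at p. cmod (\<nu> s) * norm G < 1 / 2" by (rule order_tendstoD(2)) simp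
  with ev have "\<forall>\<^sub>F s in at p. norm ((s - p) ^ Suc j *\<^sub>C Z s) \<le> cmod (s - p) ^ Suc j * (2 * (cmod (1 / s) * norm (A o\<^sub>L G)))"
  proof eventually_elim
    case (elim s)
    have "norm (Z s) \<le> norm ((1 / s) *\<^sub>C (A o\<^sub>L G)) + norm (\<nu> s *\<^sub>C (Z s o\<^sub>L G))"
      by (subst Z_eq[OF elim(1,2)]) (rule norm_triangle_ineq)
    also have "norm (\<nu> s *\<^sub>C (Z s o\<^sub>L G)) \<le> cmod (\<nu> s) * norm (Z s) * norm G"
      by (rule norm_scaleC_blinfun_compose_le)
    also have "\<dots> = norm (Z s) * (cmod (\<nu> s) * norm G)" by simp
    also have "\<dots> \<le> norm (Z s) * (1 / 2)" using elim(3) by (intro mult_left_mono) auto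
    finally have "norm (Z s) \<le> 2 * norm ((1 / s) *\<^sub>C (A o\<^sub>L G))" by simp
    then have "norm (Z s) \<le> 2 * (cmod (1 / s) * norm (A o\<^sub>L G))" by (simp only: norm_scaleC)
    then show ?case unfolding norm_scaleC norm_power by (intro mult_left_mono) auto
  qed
  moreover have "((\<lambda>s. cmod (s - p) ^ Suc j * (2 * (cmod (1 / s) * norm (A o\<^sub>L G))))
      \<longlongrightarrow> cmod (p - p) ^ Suc j * (2 * (cmod (1 / p) * norm (A o\<^sub>L G)))) (at p)"
    by (intro tendsto_intros p0)
  ultimately have limZ: "((\<lambda>s. (s - p) ^ Suc j *\<^sub>C Z s) \<longlongrightarrow> 0) (at p)"
    using Lim_null_comparison[of "\<lambda>s. (s - p) ^ Suc j *\<^sub>C Z s"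
        "\<lambda>s. cmod (s - p) ^ Suc j * (2 * (cmod (1 / s) * norm (A o\<^sub>L G)))"] by simp
  \<comment> \<open>The relation \<open>s * p * \<nu> s = s - p\<close> converts powers of \<nu>
    into powers of \<open>s - p\<close>.\<close>
  have "((\<lambda>s. (s * p) ^ Suc j *\<^sub>C \<nu> s ^ Suc j *\<^sub>C (M s o\<^sub>L Q (j - j)) + (s - p) ^ Suc j *\<^sub>C Z s)
      \<longlongrightarrow> (p * p) ^ Suc j *\<^sub>C L + 0) (at p)"
    by (intro tendsto_add limZ tendsto_scaleC lim_Q tendsto_intros order_refl)
  moreover have "\<forall>\<^sub>F s in at p. (s * p) ^ Suc j *\<^sub>C \<nu> s ^ Suc j *\<^sub>C (M s o\<^sub>L Q (j - j)) + (s - p) ^ Suc j *\<^sub>C Z s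
      = (s - p) ^ Suc j *\<^sub>C M s"
    using ev
  proof eventually_elim
    case (elim s)
    have "s * p * \<nu> s = s - p" using elim(2) p0 by (simp add: \<nu>_def \<mu>_def field_simps)
    then have "(s * p) ^ Suc j * \<nu> s ^ Suc j = (s - p) ^ Suc j"
      by (metis power_mult_distrib)
    moreover have "(M s o\<^sub>L Q 0) + Z s = M s"
      by (rule blinfun_eqI) (simp add: Q_def Z_def blinfun.add_left blinfun.diff_left blinfun.diff_right)
    ultimately show ?case
      by (metis diff_self_eq_0 scaleC_add_right scaleC_scaleC)
  qed
  ultimately have "((\<lambda>s. (s - p) ^ Suc j *\<^sub>C M s) \<longlongrightarrow> (p * p) ^ Suc j *\<^sub>C L) (at p)"
    by (simp add: Lim_transform_eventually)
  moreover have "(p * p) ^ Suc j *\<^sub>C L \<noteq> 0" using L0 p0 by simp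
  ultimately show ?thesis by blast
qed

text \<open>The relation \<open>id\<close> determines every \<open>A s\<close> from
  \<open>A 0\<close>. Any extension inherits it by continuation, which confines its poles to the
  singular set; conversely A (1 + s A)^-1, with A standing for \<open>A 0\<close>, is an extension
  whose singular points are all genuine poles.\<close>

lemma extension_poles_eq_singular_set:
  fixes A :: "real \<Rightarrow> ('a::complex_hilbert_space \<Rightarrow>\<^sub>L 'a)"
  assumes A: "compact_op (A 0)" and id: "\<And>s x. A s (x + complex_of_real s *\<^sub>C A 0 x) = A 0 x"
  shows "extension_poles A = singular_set (A 0)"
proof (intro set_eqI iffI)
  fix r assume "r \<in> extension_poles A"
  then obtain M S where ext: "meromorphic_extension A M S" and r: "r \<in> S"
    by (auto simp: extension_poles_def)
  from ext r obtain n L where "n > 0" "L \<noteq> 0" "((\<lambda>s. (s - r) ^ n *\<^sub>C M s) \<longlongrightarrow> L) (at r)"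
    and "\<not> r islimpt S" and lin: "\<And>s. s \<notin> S \<Longrightarrow> complex_linear (M s)"
    unfolding meromorphic_extension_def by blast
  then show "r \<in> singular_set (A 0)"
    using pole_in_singular_set[OF A meromorphic_extension_identity[OF ext id]] by blast
next
  fix r assume r: "r \<in> singular_set (A 0)"
  let ?S = "singular_set (A 0)"
  have lin: "complex_linear (A 0)" using A by (simp add: compact_op_def)
  obtain M where M: "\<And>s. s \<notin> ?S \<Longrightarrow> complex_linear (M s)"
    "\<And>s x. s \<notin> ?S \<Longrightarrow> blinfun_apply (M s) (x + s *\<^sub>C A 0 x) = A 0 x"
    "\<And>s x. s \<notin> ?S \<Longrightarrow> M s x + s *\<^sub>C A 0 (M s x) = A 0 x"
    using meromorphic_family[OF A] by blast
  have "norm_holomorphic_on M (- ?S)"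
    by (rule meromorphic_family_holomorphic)
       (use meromorphic_family_difference[OF lin M(1) M(2) M(3)] in auto)
  \<comment> \<open>At a real singular point \<open>id\<close> applied to the null vector gives
    \<open>A 0 x = 0\<close>, and then \<open>x = 0\<close>.\<close>
  moreover have real: "complex_of_real s \<notin> ?S" for s
  proof
    assume "complex_of_real s \<in> ?S"
    then obtain x where x: "x \<noteq> 0" "x + complex_of_real s *\<^sub>C A 0 x = 0"
      unfolding singular_set_def by blast
    then have "A 0 x = 0" using id[of s x] by (simp add: blinfun.zero_right)
    with x show False by simp
  qed
  moreover have "M (complex_of_real s) = A s" for s
  proof (rule blinfun_eqI)
    fix x
    obtain N where "complex_linear N" "\<And>x. blinfun_apply N (x + complex_of_real s *\<^sub>C A 0 x) = x"
        and N: "\<And>x. N x + complex_of_real s *\<^sub>C A 0 (N x) = x"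
      using fredholm_inverse[OF A real[of s]] by blast
    then show "M (complex_of_real s) x = A s x"
      using id[of s "N x"] M(2)[OF real, of s "N x"] by (simp only: N)
  qed
  ultimately have "meromorphic_extension A M ?S"
    unfolding meromorphic_extension_def
    using singular_set_not_islimpt[OF A] M(1) singular_set_pole[OF A _ M(1,2)]
    by (intro conjI allI ballI) auto
  with r show "r \<in> extension_poles A" by (auto simp: extension_poles_def)
qed

section \<open>Generalized eigenspaces of intertwined operators\<close>

lemma closure_limitI: "(\<And>n::nat. f n \<in> U) \<Longrightarrow> f \<longlonglongrightarrow> x \<Longrightarrow> x \<in> closure (U :: 'a::metric_space set)"
  using closure_sequential by blast

lemma subspace_closure:
  fixes U :: "'a::real_normed_vector set"
  assumes U: "subspace U"
  shows "subspace (closure U)"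
proof (rule subspaceI)
  show "0 \<in> closure U" using subspace_0[OF U] closure_subset by blast
next
  fix x y assume "x \<in> closure U" "y \<in> closure U"
  then obtain f g where "\<And>n. f n \<in> U" "f \<longlonglongrightarrow> x" "\<And>n. g n \<in> U" "g \<longlonglongrightarrow> y"
    unfolding closure_sequential by blast
  then show "x + y \<in> closure U"
    by (intro closure_limitI[where f = "\<lambda>n. f n + g n"] subspace_add[OF U] tendsto_add)
next
  fix c x assume "x \<in> closure U"
  then obtain f where "\<And>n. f n \<in> U" "f \<longlonglongrightarrow> x"
    unfolding closure_sequential by blast
  then show "c *\<^sub>R x \<in> closure U"
    by (intro closure_limitI[where f = "\<lambda>n. c *\<^sub>R f n"] subspace_scale[OF U] tendsto_scaleR tendsto_const)
qed

text \<open>\<open>W G\<close> is the projection along the nilpotent part, so it kills every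
  \<open>x\<close> annihilated by some power of \<open>W\<close>, however \<open>n\<close> compares
  with \<open>m\<close>.\<close>

lemma drazin_inverse_nilpotent_part:
  assumes G: "is_drazin_inverse W G m" and W0: "W 0 = 0" and x: "(W ^^ n) x = 0"
  shows "W (G x) = 0"
  using x
proof (induction n arbitrary: x)
  case 0
  then show ?case by (simp add: blinfun.zero_right W0)
next
  case (Suc n)
  then have "W (G (W x)) = 0" by (simp add: funpow_swap1)
  then have "G (W (W (G x))) = 0"
    by (simp only: is_drazin_inverseD(2)[OF G] blinfun.zero_right)
  moreover have "W (G x) = W (G (W (G x)))" by (simp only: is_drazin_inverseD(3)[OF G])
  moreover have "\<dots> = G (W (W (G x)))" by (simp only: is_drazin_inverseD(2)[OF G])
  ultimately show ?case by simp
qed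

lemma drazin_inverse_funpow:
  assumes G: "is_drazin_inverse W G m"
  shows "G ((W ^^ n) x) = (W ^^ n) (G x)"
  by (induction n) (simp_all add: is_drazin_inverseD(2)[OF G])

text \<open>\<open>W G\<close> is idempotent and its factors commute, so W G = W^n (W G) G^n for
  every n.\<close>

lemma drazin_inverse_range_funpow:
  assumes G: "is_drazin_inverse W G m"
  shows "\<exists>v. W (G x) = (W ^^ n) v"
proof -
  have "\<exists>v. W (G x) = (W ^^ n) (W (G v))"
  proof (induction n)
    case 0
    show ?case by (intro exI[of _ x]) simp
  next
    case (Suc n)
    then obtain v where v: "W (G x) = (W ^^ n) (W (G v))" by blast
    have "(W ^^ Suc n) (W (G (G v))) = (W ^^ n) (W (W (G (G v))))"
      by (simp add: funpow_swap1)
    also have "W (W (G (G v))) = W (G (W (G v)))" by (simp only: is_drazin_inverseD(2)[OF G])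
    also have "\<dots> = W (G v)" by (simp only: is_drazin_inverseD(3)[OF G])
    finally show ?case using v by (intro exI[of _ "G v"]) simp
  qed
  then show ?thesis by blast
qed

definition generalized_eigenspace :: "('k::complex_normed_vector \<Rightarrow>\<^sub>L 'k) \<Rightarrow> complex \<Rightarrow> 'k set" where
  "generalized_eigenspace A \<mu> = {x. \<exists>n. ((\<lambda>v. A v - \<mu> *\<^sub>C v) ^^ n) x = 0}"

text \<open>The inclusion from left to right is the intertwining relation. For the other one, a
  generalized eigenvector of \<open>A\<close> is approximated from the range of \<open>X\<close>.
  Since \<open>PA X = X PB\<close>, applying \<open>PA\<close> moves the approximants into the image
  of the generalized eigenspace of \<open>B\<close>, and that image is closed.\<close>

lemma generalized_eigenspace_transfer:
  fixes B :: "'h::complex_hilbert_space \<Rightarrow>\<^sub>L 'h" and A :: "'k::complex_hilbert_space \<Rightarrow>\<^sub>L 'k"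
  assumes B: "compact_op B" and A: "compact_op A"
    and X: "complex_linear X" "\<And>h. blinfun_apply X h = 0 \<Longrightarrow> h = 0"
    and inter: "\<And>h. X (B h) = A (X h)"
    and ran: "\<And>k. A k \<in> closure (range (blinfun_apply X))" and mu: "\<mu> \<noteq> 0"
  shows "X ` generalized_eigenspace B \<mu> = generalized_eigenspace A \<mu>"
proof
  define WA where "WA = (\<lambda>v. A v - \<mu> *\<^sub>C v)"
  define WB where "WB = (\<lambda>v. B v - \<mu> *\<^sub>C v)"
  obtain GA mA where GA: "is_drazin_inverse WA GA mA"
    using ex_drazin_inverse[OF A mu] unfolding WA_def by blast
  obtain GB mB where GB: "is_drazin_inverse WB GB mB"
    using ex_drazin_inverse[OF B mu] unfolding WB_def by blast
  have EA: "generalized_eigenspace A \<mu> = {x. \<exists>n. (WA ^^ n) x = 0}"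
    by (simp add: generalized_eigenspace_def WA_def)
  have EB: "generalized_eigenspace B \<mu> = {x. \<exists>n. (WB ^^ n) x = 0}"
    by (simp add: generalized_eigenspace_def WB_def)
  interpret WA: bounded_linear WA unfolding WA_def by (rule bounded_linear_shift)
  interpret WB: bounded_linear WB unfolding WB_def by (rule bounded_linear_shift)
  interpret WAm: bounded_linear "WA ^^ mA" unfolding WA_def by (rule shift_funpow[OF A mu])
  interpret WBm: bounded_linear "WB ^^ mB" unfolding WB_def by (rule shift_funpow[OF B mu])
  have XW: "X (WB h) = WA (X h)" for h
    by (simp add: WA_def WB_def blinfun.diff_right inter complex_linear_scaleC[OF X(1)])
  have XWn: "X ((WB ^^ n) h) = (WA ^^ n) (X h)" for n h
    by (induction n) (simp_all add: XW)
  show le: "X ` generalized_eigenspace B \<mu> \<subseteq> generalized_eigenspace A \<mu>"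
  proof
    fix x assume "x \<in> X ` generalized_eigenspace B \<mu>"
    then obtain h n where "x = X h" "(WB ^^ n) h = 0" unfolding EB by blast
    then show "x \<in> generalized_eigenspace A \<mu>"
      using XWn[of n h] unfolding EA by (auto simp: blinfun.zero_right)
  qed
  define PA where "PA x = x - WA (GA x)" for x
  define PB where "PB h = h - WB (GB h)" for h
  have PA_lim: "(\<lambda>n. PA (f n)) \<longlonglongrightarrow> PA l" if "f \<longlonglongrightarrow> l" for f l
    unfolding PA_def by (intro tendsto_diff that WA.tendsto blinfun.tendsto[OF tendsto_const])
  have PA_diff: "PA (x + y) = PA x + PA y" for x y
    by (simp add: PA_def blinfun.add_right WA.add)
  have PB_E: "(WB ^^ mB) (PB h) = 0" for h
    using is_drazin_inverseD(4)[OF GB, of h] by (simp add: PB_def WBm.diff funpow_swap1)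
  have EB': "generalized_eigenspace B \<mu> = {h. (WB ^^ mB) h = 0}"
  proof -
    have "(WB ^^ mB) h = 0" if "(WB ^^ n) h = 0" for n h
      using PB_E[of h] drazin_inverse_nilpotent_part[OF GB WB.zero that] by (simp add: PB_def)
    then show ?thesis unfolding EB by blast
  qed
  have PA_X: "PA (X h) = X (PB h)" for h
  proof -
    \<comment> \<open>The exponent is that of \<open>A\<close>, not of \<open>B\<close>: after
      applying \<open>X\<close> this part lies in the range of \<open>WA ^^ mA\<close>, which
      \<open>PA\<close> annihilates.\<close>
    obtain v where v: "WB (GB h) = (WB ^^ mA) v" using drazin_inverse_range_funpow[OF GB] by blast
    have "X (PB h) \<in> generalized_eigenspace A \<mu>" using le PB_E unfolding EB by blast
    then obtain n where "(WA ^^ n) (X (PB h)) = 0" unfolding EA by blast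
    then have 1: "PA (X (PB h)) = X (PB h)"
      using drazin_inverse_nilpotent_part[OF GA WA.zero] by (simp add: PA_def)
    have "WA (GA ((WA ^^ mA) (X v))) = (WA ^^ mA) (X v)"
      using is_drazin_inverseD(4)[OF GA, of "X v"] by (simp add: drazin_inverse_funpow[OF GA])
    then have 2: "PA (X (WB (GB h))) = 0" by (simp add: v XWn PA_def)
    have "X h = X (PB h) + X (WB (GB h))" by (simp add: PB_def blinfun.diff_right)
    then show ?thesis using 1 2 by (metis PA_diff add.right_neutral)
  qed
  have sub: "subspace (closure (range (blinfun_apply X)))"
    by (intro subspace_closure linear_subspace_image bounded_linear.linear blinfun.bounded_linear_right subspace_UNIV)
  have scl: "c *\<^sub>C x \<in> closure (range (blinfun_apply X))" if x: "x \<in> closure (range (blinfun_apply X))" for c x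
  proof -
    obtain f where f: "\<And>n. f n \<in> range (blinfun_apply X)" "f \<longlonglongrightarrow> x"
      using x unfolding closure_sequential by blast
    have "(\<lambda>n. c *\<^sub>C f n) \<longlonglongrightarrow> c *\<^sub>C x" using tendsto_scaleC[OF tendsto_const f(2)] .
    moreover have "c *\<^sub>C f n \<in> range (blinfun_apply X)" for n
    proof -
      obtain v where "f n = X v" using f(1) by blast
      then have "c *\<^sub>C f n = X (c *\<^sub>C v)" by (simp add: complex_linear_scaleC[OF X(1)])
      then show ?thesis by blast
    qed
    ultimately show ?thesis by (rule closure_limitI[rotated])
  qed
  \<comment> \<open>Write \<open>x = (A x - WA x) / \<mu>\<close>: the first term is covered by
    \<open>ran\<close>, the second by induction on the nilpotency order.\<close>
  have EA_closure: "x \<in> closure (range (blinfun_apply X))" if "(WA ^^ n) x = 0" for n x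
    using that
  proof (induction n arbitrary: x)
    case 0
    then show ?case using subspace_0[OF sub] by simp
  next
    case (Suc n)
    then have "WA x \<in> closure (range (blinfun_apply X))" by (simp add: funpow_swap1)
    then have "(1 / \<mu>) *\<^sub>C (A x - WA x) \<in> closure (range (blinfun_apply X))"
      using ran[of x] by (intro scl subspace_diff[OF sub])
    moreover have "(1 / \<mu>) *\<^sub>C (A x - WA x) = x" using mu by (simp add: WA_def)
    ultimately show ?case by simp
  qed
  \<comment> \<open>On the kernel of \<open>WB ^^ mB\<close>, properness of that power says that
    bounded sequences have convergent subsequences, which is finite dimension in disguise. Hence
    every map is proper on it, and an injective bounded linear one has closed image.\<close>
  have cl: "closed (X ` generalized_eigenspace B \<mu>)"
  proof (rule proper_on_closed_image)
    show "closed (generalized_eigenspace B \<mu>)" "subspace (generalized_eigenspace B \<mu>)"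
      unfolding EB' WB_def by (rule kernel_shift_funpow[OF B mu])+
    have p: "proper_on (WB ^^ mB) UNIV" unfolding WB_def by (rule shift_funpow[OF B mu])
    show "proper_on (blinfun_apply X) (generalized_eigenspace B \<mu>)"
      unfolding proper_on_def
    proof (intro allI impI, elim conjE)
      fix x :: "nat \<Rightarrow> 'h"
      assume x: "\<forall>n. x n \<in> generalized_eigenspace B \<mu>" "bounded (range x)"
      then have "convergent (\<lambda>n. (WB ^^ mB) (x n))" by (simp add: EB' convergent_const)
      then show "\<exists>r. strict_mono r \<and> convergent (x \<circ> r)"
        using p x(2) unfolding proper_on_def by blast
    qed
  qed (use X(2) blinfun.bounded_linear_right in auto)
  show "generalized_eigenspace A \<mu> \<subseteq> X ` generalized_eigenspace B \<mu>"
  proof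
    fix x assume "x \<in> generalized_eigenspace A \<mu>"
    then obtain n where n: "(WA ^^ n) x = 0" unfolding EA by blast
    obtain f where f: "\<And>n. f n \<in> range (blinfun_apply X)" "f \<longlonglongrightarrow> x"
      using EA_closure[OF n] unfolding closure_sequential by blast
    have "PA x = x" using drazin_inverse_nilpotent_part[OF GA WA.zero n] by (simp add: PA_def)
    then have "(\<lambda>n. PA (f n)) \<longlonglongrightarrow> x" using PA_lim[OF f(2)] by simp
    moreover have "PA (f n) \<in> X ` generalized_eigenspace B \<mu>" for n
    proof -
      obtain h where "f n = X h" using f(1) by blast
      then have "PA (f n) = X (PB h)" by (simp add: PA_X)
      moreover have "PB h \<in> generalized_eigenspace B \<mu>" unfolding EB' by (simp add: PB_E)
      ultimately show ?thesis by blast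
    qed
    ultimately show "x \<in> X ` generalized_eigenspace B \<mu>"
      by (rule closed_sequentially[OF cl, rotated])
  qed
qed

text \<open>A basis is carried to a basis. If it is infinite, both dimensions are 0 by the
  convention for \<open>card\<close>.\<close>

lemma complex_dim_injective_image:
  fixes X :: "'h::complex_normed_vector \<Rightarrow>\<^sub>L 'k::complex_normed_vector"
  assumes X: "complex_linear X" "\<And>h. blinfun_apply X h = 0 \<Longrightarrow> h = 0"
  shows "complex_vector.dim (X ` E) = complex_vector.dim E"
proof -
  interpret p: vector_space_pair "scaleC :: complex \<Rightarrow> 'h \<Rightarrow> 'h" "scaleC :: complex \<Rightarrow> 'k \<Rightarrow> 'k"
    by unfold_locales
  have lin: "Vector_Spaces.linear scaleC scaleC (blinfun_apply X)"
    by unfold_locales (simp_all add: blinfun.add_right complex_linear_scaleC[OF X(1)])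
  have inj: "inj (blinfun_apply X)"
    using X(2) by (auto simp: inj_def) (metis blinfun.diff_right eq_iff_diff_eq_0)
  obtain S where S: "S \<subseteq> E" "complex_vector.independent S" "E \<subseteq> complex_vector.span S"
    "card S = complex_vector.dim E"
    using complex_vector.basis_exists by blast
  have "complex_vector.span S = complex_vector.span E"
    using S by (metis complex_vector.span_eq complex_vector.span_superset subset_trans)
  then have "complex_vector.span (X ` S) = complex_vector.span (X ` E)"
    by (simp add: p.linear_span_image[OF lin])
  moreover have "complex_vector.independent (X ` S)"
    using p.linear_independent_injective_image[OF lin S(2)] inj by (meson inj_on_subset subset_UNIV)
  ultimately have "complex_vector.dim (X ` E) = card (X ` S)"
    by (metis complex_vector.dim_eq_card)
  also have "\<dots> = card S" using inj by (intro card_image) (rule inj_on_subset, auto)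
  finally show ?thesis using S(4) by simp
qed

text \<open>The last non-zero iterate of a generalized eigenvector is an eigenvector.\<close>

lemma singular_set_iff_generalized_eigenspace:
  assumes "complex_linear (A :: 'a::complex_normed_vector \<Rightarrow>\<^sub>L 'a)"
  shows "s \<in> singular_set A \<longleftrightarrow> s \<noteq> 0 \<and> (\<exists>x\<in>generalized_eigenspace A (- 1 / s). x \<noteq> 0)"
proof (cases "s = 0")
  case False
  define W where "W = (\<lambda>v. A v - (- 1 / s) *\<^sub>C v)"
  have sW: "x + s *\<^sub>C A x = s *\<^sub>C W x" for x
    using False by (simp add: W_def scaleC_add_right)
  have "s \<in> singular_set A \<longleftrightarrow> (\<exists>x. x \<noteq> 0 \<and> x + s *\<^sub>C A x = 0)"
    by (simp add: singular_set_def)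
  also have "\<dots> \<longleftrightarrow> (\<exists>x. x \<noteq> 0 \<and> W x = 0)"
    unfolding sW using False by simp
  also have "\<dots> \<longleftrightarrow> (\<exists>x. x \<noteq> 0 \<and> (\<exists>n. (W ^^ n) x = 0))"
  proof
    assume "\<exists>x. x \<noteq> 0 \<and> W x = 0"
    then obtain x where "x \<noteq> 0" "(W ^^ 1) x = 0" by auto
    then show "\<exists>x. x \<noteq> 0 \<and> (\<exists>n. (W ^^ n) x = 0)" by blast
  next
    assume "\<exists>x. x \<noteq> 0 \<and> (\<exists>n. (W ^^ n) x = 0)"
    then obtain x n where "x \<noteq> 0" "(W ^^ n) x = 0" by blast
    then show "\<exists>x. x \<noteq> 0 \<and> W x = 0"
    proof (induction n)
      case (Suc n)
      then show ?case by (cases "(W ^^ n) x = 0") auto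
    qed simp
  qed
  finally show ?thesis using False unfolding generalized_eigenspace_def W_def by blast
qed (simp add: singular_set_def)

section \<open>Unbounded operators\<close>

lemma linear_opD:
  assumes "linear_op A"
  shows "(x, u) \<in> A \<Longrightarrow> (x, v) \<in> A \<Longrightarrow> u = v" "(0, 0) \<in> A"
    "(x, u) \<in> A \<Longrightarrow> (y, v) \<in> A \<Longrightarrow> (x + y, u + v) \<in> A" "(x, u) \<in> A \<Longrightarrow> (c *\<^sub>C x, c *\<^sub>C u) \<in> A"
    "(x, u) \<in> A \<Longrightarrow> (y, v) \<in> A \<Longrightarrow> (x - y, u - v) \<in> A"
proof -
  show add: "(x, u) \<in> A \<Longrightarrow> (y, v) \<in> A \<Longrightarrow> (x + y, u + v) \<in> A" for x y u v
    using assms unfolding linear_op_def by blast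
  show sc: "(x, u) \<in> A \<Longrightarrow> (c *\<^sub>C x, c *\<^sub>C u) \<in> A" for c x u
    using assms unfolding linear_op_def by blast
  show "(x, u) \<in> A \<Longrightarrow> (x, v) \<in> A \<Longrightarrow> u = v" "(0, 0) \<in> A"
    using assms unfolding linear_op_def single_valued_def by blast+
  show "(x, u) \<in> A \<Longrightarrow> (y, v) \<in> A \<Longrightarrow> (x - y, u - v) \<in> A"
    using add[of x u "- y" "- v"] sc[of y v "- 1"] by simp
qed

lemma linear_op_subspace:
  assumes "linear_op (A :: ('a::complex_normed_vector, 'b::complex_normed_vector) partial_op)"
  shows "subspace A"
proof (rule subspaceI)
  show "0 \<in> A" using linear_opD(2)[OF assms] by (simp add: zero_prod_def)
  show "x + y \<in> A" if "x \<in> A" "y \<in> A" for x y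
    using linear_opD(3)[OF assms, of "fst x" "snd x" "fst y" "snd y"] that by (simp add: plus_prod_def)
  show "r *\<^sub>R x \<in> A" if "x \<in> A" for r x
    using linear_opD(4)[OF assms, of "fst x" "snd x" "complex_of_real r"] that
    by (simp add: scaleR_prod_def scaleC_of_real)
qed

lemma adjoint_opD: "(y, w) \<in> adjoint_op A \<Longrightarrow> (x, u) \<in> A \<Longrightarrow> cinner u y = cinner x w"
  by (simp add: adjoint_op_def)

lemma adjoint_op_linear_graph:
  shows "(y, w) \<in> adjoint_op A \<Longrightarrow> (y', w') \<in> adjoint_op A \<Longrightarrow> (y + y', w + w') \<in> adjoint_op A"
    "(y, w) \<in> adjoint_op A \<Longrightarrow> (c *\<^sub>C y, c *\<^sub>C w) \<in> adjoint_op A"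
  by (auto simp: adjoint_op_def cinner_add_right cinner_scaleC_right)

text \<open>The imaginary part of \<open>cinner x y\<close> is the real part of
  \<open>cinner x (\<i> y)\<close>. Real projections onto subspaces closed under multiplication by
  \<i> thus give complex orthogonality.\<close>

lemma inner_eq_0_imp_cinner_eq_0:
  fixes x y :: "'a::complex_hilbert_space"
  assumes "inner x y = 0" "inner x (\<i> *\<^sub>C y) = 0"
  shows "cinner x y = 0"
  using assms by (simp add: complex_eq_iff cinner_scaleC_right flip: Re_cinner)

text \<open>Von Neumann: project \<open>(0, y)\<close>, where \<open>y\<close> is orthogonal to the domain of the adjoint, onto the
  graph; the orthogonal complement of the graph is the rotated graph of the adjoint.\<close>

lemma closure_Domain_adjoint_op:
  fixes F :: "('a::complex_hilbert_space, 'b::complex_hilbert_space) partial_op"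
  assumes F: "linear_op F" "closed F"
  shows "closure (Domain (adjoint_op F)) = UNIV"
proof -
  let ?U = "Domain (adjoint_op F)"
  have "subspace ?U"
  proof (rule subspaceI)
    show "0 \<in> ?U" by (rule DomainI[of _ 0]) (simp add: adjoint_op_def)
    show "x + y \<in> ?U" if "x \<in> ?U" "y \<in> ?U" for x y
      using that adjoint_op_linear_graph(1) by (metis DomainE DomainI)
    show "r *\<^sub>R x \<in> ?U" if "x \<in> ?U" for r x
      using that adjoint_op_linear_graph(2)[of _ _ F "complex_of_real r"] by (metis DomainE DomainI scaleC_of_real)
  qed
  then have U: "closed (closure ?U)" "subspace (closure ?U)" by (simp_all add: subspace_closure)
  have "x \<in> closure ?U" for x
  proof -
    obtain p where p: "p \<in> closure ?U" "\<And>u. u \<in> closure ?U \<Longrightarrow> inner (x - p) u = 0"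
      using closed_subspace_orthogonal_decomposition[OF U, of x] by blast
    define y where "y = x - p"
    have y: "inner y u = 0" if "u \<in> ?U" for u
      using p(2) that closure_subset unfolding y_def by blast
    obtain q where q: "q \<in> F" "\<And>v. v \<in> F \<Longrightarrow> inner ((0, y) - q) v = 0"
      using closed_subspace_orthogonal_decomposition[OF F(2) linear_op_subspace[OF F(1)], of "(0, y)"] by blast
    obtain a b where ab: "q = (a, b)" by (cases q)
    have orth: "inner (y - b) u = inner a v" if "(v, u) \<in> F" for u v
      using q(2)[OF that] by (simp add: ab inner_prod_def inner_diff_left)
    have "(y - b, a) \<in> adjoint_op F"
      unfolding adjoint_op_def
    proof (clarsimp)
      fix v u assume vu: "(v, u) \<in> F"
      have "cinner (y - b) u - cinner a v = 0"
      proof (rule complex_eqI)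
        show "Re (cinner (y - b) u - cinner a v) = Re 0"
          using orth[OF vu] by (simp add: Re_cinner)
        have "Re (cinner (y - b) (\<i> *\<^sub>C u)) = Re (cinner a (\<i> *\<^sub>C v))"
          unfolding Re_cinner by (rule orth[OF linear_opD(4)[OF F(1) vu]])
        then show "Im (cinner (y - b) u - cinner a v) = Im 0"
          by (simp add: cinner_scaleC_right)
      qed
      then have "cinner (y - b) u = cinner a v" by simp
      then show "cinner u (y - b) = cinner v a" by (metis cinner_commute)
    qed
    \<comment> \<open>The residual \<open>y - b\<close> lies in the domain of the adjoint, to which
      \<open>y\<close> is orthogonal. With \<open>inner (y - b) b = inner a a\<close> the sum of the
      two squared norms vanishes.\<close>
    then have "inner y (y - b) = 0" by (intro y) blast
    moreover have "inner (y - b) b = inner a a" using orth q(1) ab by blast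
    ultimately have "inner (y - b) (y - b) + inner a a = 0"
      by (simp add: inner_diff_left inner_diff_right inner_commute)
    then have "y - b = 0" "a = 0"
      by (metis add_nonneg_eq_0_iff inner_ge_zero inner_eq_zero_iff)+
    then have "(0, y) \<in> F" using q(1) ab by simp
    then have "y = 0" using linear_opD(1,2)[OF F(1)] by blast
    then show ?thesis using p(1) by (simp add: y_def)
  qed
  then show ?thesis by blast
qed

section \<open>Resolvents of self-adjoint operators at non-real points\<close>

lemma resolvent_op_iff: "(w, g) \<in> resolvent_op G z \<longleftrightarrow> (g, w + z *\<^sub>C g) \<in> G"
proof
  assume "(g, w + z *\<^sub>C g) \<in> G"
  moreover have "w = (w + z *\<^sub>C g) - z *\<^sub>C g" by simp
  ultimately show "(w, g) \<in> resolvent_op G z" unfolding resolvent_op_def by blast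
qed (auto simp: resolvent_op_def)

lemma self_adjoint_opD:
  assumes "self_adjoint_op G"
  shows "linear_op G" "(x, u) \<in> G \<Longrightarrow> (y, v) \<in> G \<Longrightarrow> cinner u y = cinner x v"
    "(\<And>x u. (x, u) \<in> G \<Longrightarrow> cinner u y = cinner x v) \<Longrightarrow> (y, v) \<in> G"
proof -
  have G: "adjoint_op G = G" "linear_op G" using assms by (auto simp: self_adjoint_op_def)
  show "linear_op G" by fact
  show "(x, u) \<in> G \<Longrightarrow> (y, v) \<in> G \<Longrightarrow> cinner u y = cinner x v"
    using G(1) adjoint_opD by blast
  assume "\<And>x u. (x, u) \<in> G \<Longrightarrow> cinner u y = cinner x v"
  then have "(y, v) \<in> adjoint_op G" by (simp add: adjoint_op_def)
  then show "(y, v) \<in> G" using G(1) by simp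
qed

lemma self_adjoint_Im:
  assumes G: "self_adjoint_op G" and g: "(g, w + z *\<^sub>C g) \<in> G"
  shows "Im (cinner w g) = - Im z * (norm g)\<^sup>2"
proof -
  have "cinner (w + z *\<^sub>C g) g = cinner g (w + z *\<^sub>C g)" by (rule self_adjoint_opD(2)[OF G g g])
  also have "\<dots> = cnj (cinner (w + z *\<^sub>C g) g)" by (rule cinner_commute)
  finally have "Im (cinner (w + z *\<^sub>C g) g) = 0" by (simp add: complex_eq_iff)
  then show ?thesis by (simp add: cinner_add_left cinner_scaleC_left cinner_self)
qed

lemma self_adjoint_norm_bound:
  assumes G: "self_adjoint_op G" and g: "(g, w + z *\<^sub>C g) \<in> G"
  shows "\<bar>Im z\<bar> * norm g \<le> norm w"
proof (cases "g = 0")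
  case False
  have "\<bar>Im z\<bar> * (norm g)\<^sup>2 = \<bar>Im (cinner w g)\<bar>"
    by (simp add: self_adjoint_Im[OF G g] abs_mult)
  also have "\<dots> \<le> norm w * norm g"
    using abs_Im_le_cmod norm_cinner_le order_trans by blast
  finally have "\<bar>Im z\<bar> * norm g * norm g \<le> norm w * norm g" by (simp add: power2_eq_square)
  then show ?thesis using False by simp
qed simp

lemma self_adjoint_closed:
  assumes G: "self_adjoint_op G" and "\<And>n::nat. (f n, h n) \<in> G" "f \<longlonglongrightarrow> x" "h \<longlonglongrightarrow> u"
  shows "(x, u) \<in> G"
proof (rule self_adjoint_opD(3)[OF G])
  fix y v assume yv: "(y, v) \<in> G"
  have lim: "(\<lambda>n. cinner y (k n)) \<longlonglongrightarrow> cinner y l" if "k \<longlonglongrightarrow> l" for k l y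
  proof -
    have "(\<lambda>n. cnj (cinner (k n) y)) \<longlonglongrightarrow> cnj (cinner l y)"
      by (intro tendsto_cnj bounded_linear.tendsto[OF bounded_linear_cinner_left] that)
    then show ?thesis unfolding cinner_commute[symmetric] .
  qed
  have "(\<lambda>n. cinner y (h n)) \<longlonglongrightarrow> cinner v x"
    using lim[OF assms(3), of v] self_adjoint_opD(2)[OF G yv assms(2)] by simp
  then show "cinner v x = cinner y u" using lim[OF assms(4)] LIMSEQ_unique by blast
qed

text \<open>The range of \<open>G - z\<close> is closed by the lower bound
  \<open>self_adjoint_norm_bound\<close>. A vector orthogonal to it is an eigenvector of the
  adjoint, that is of \<open>G\<close>, for \<open>cnj z\<close>, and the same bound excludes
  this.\<close>

lemma self_adjoint_surj:
  assumes G: "self_adjoint_op G" and z: "Im z \<noteq> 0"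
  shows "\<exists>g. (g, w + z *\<^sub>C g) \<in> G"
proof -
  note lin = self_adjoint_opD(1)[OF G]
  define U where "U = {w. \<exists>g. (g, w + z *\<^sub>C g) \<in> G}"
  have add: "(g + g', (w + w') + z *\<^sub>C (g + g')) \<in> G"
    if "(g, w + z *\<^sub>C g) \<in> G" "(g', w' + z *\<^sub>C g') \<in> G" for g g' w w'
    using linear_opD(3)[OF lin that] by (simp add: scaleC_add_right algebra_simps)
  have sc: "(c *\<^sub>C g, c *\<^sub>C w + z *\<^sub>C c *\<^sub>C g) \<in> G" if "(g, w + z *\<^sub>C g) \<in> G" for c g w
    using linear_opD(4)[OF lin that, of c] by (simp add: scaleC_add_right mult.commute)
  have scU: "c *\<^sub>C w \<in> U" if "w \<in> U" for c w using that sc unfolding U_def by blast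
  have subU: "subspace U"
  proof (rule subspaceI)
    show "0 \<in> U" using linear_opD(2)[OF lin] unfolding U_def by (auto intro!: exI[of _ 0])
    show "x + y \<in> U" if "x \<in> U" "y \<in> U" for x y using that add unfolding U_def by blast
    show "r *\<^sub>R x \<in> U" if "x \<in> U" for r x using scU[OF that, of "complex_of_real r"] by (simp add: scaleC_of_real)
  qed
  have clU: "closed U"
  proof (rule closed_sequential_limits[THEN iffD2], intro allI impI, elim conjE)
    fix f l assume f: "\<forall>n. f n \<in> U" "f \<longlonglongrightarrow> l"
    then obtain g where g: "\<And>n. (g n, f n + z *\<^sub>C g n) \<in> G" unfolding U_def by (simp; metis)
    have le: "\<bar>Im z\<bar> * norm (g m - g n) \<le> norm (f m - f n)" for m n
    proof (rule self_adjoint_norm_bound[OF G])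
      show "(g m - g n, f m - f n + z *\<^sub>C (g m - g n)) \<in> G"
        using linear_opD(5)[OF lin g[of m] g[of n]]
        by (simp add: complex_vector.scale_right_diff_distrib algebra_simps)
    qed
    have "Cauchy g"
    proof (rule metric_CauchyI)
      fix e :: real assume "e > 0"
      then obtain N where N: "\<And>m n. m \<ge> N \<Longrightarrow> n \<ge> N \<Longrightarrow> dist (f m) (f n) < \<bar>Im z\<bar> * e"
        using metric_CauchyD[OF LIMSEQ_imp_Cauchy[OF f(2)], of "\<bar>Im z\<bar> * e"] z by auto
      have "dist (g m) (g n) < e" if "m \<ge> N" "n \<ge> N" for m n
      proof -
        have "\<bar>Im z\<bar> * dist (g m) (g n) < \<bar>Im z\<bar> * e"
          using le[of m n] N[OF that] by (simp add: dist_norm)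
        then show ?thesis using z by simp
      qed
      then show "\<exists>N. \<forall>m\<ge>N. \<forall>n\<ge>N. dist (g m) (g n) < e" by blast
    qed
    then obtain a where a: "g \<longlonglongrightarrow> a" using Cauchy_convergent convergent_def by blast
    have "(a, l + z *\<^sub>C a) \<in> G"
      by (rule self_adjoint_closed[OF G g a]) (intro tendsto_add f tendsto_scaleC tendsto_const a)
    then show "l \<in> U" unfolding U_def by blast
  qed
  obtain p where p: "p \<in> U" "\<And>u. u \<in> U \<Longrightarrow> inner (w - p) u = 0"
    using closed_subspace_orthogonal_decomposition[OF clU subU, of w] by blast
  define y where "y = w - p"
  have y: "cinner u y = 0" if "u \<in> U" for u
  proof -
    have "cinner y u = 0"
      unfolding y_def by (intro inner_eq_0_imp_cinner_eq_0 p that scU)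
    then show ?thesis by (metis cinner_commute complex_cnj_zero)
  qed
  have "(y, cnj z *\<^sub>C y) \<in> G"
  proof (rule self_adjoint_opD(3)[OF G])
    fix x u assume "(x, u) \<in> G"
    then have "u - z *\<^sub>C x \<in> U" unfolding U_def by (auto intro!: exI[of _ x])
    from y[OF this] show "cinner u y = cinner x (cnj z *\<^sub>C y)"
      by (simp add: cinner_diff_left cinner_scaleC_left cinner_scaleC_right)
  qed
  then have "\<bar>Im (cnj z)\<bar> * norm y \<le> norm (0 :: 'a)"
    by (intro self_adjoint_norm_bound[OF G]) simp
  then have "\<bar>Im z\<bar> * norm y \<le> 0" by simp
  then have "y = 0" using z by (simp add: mult_le_0_iff)
  then show ?thesis using p(1) unfolding y_def U_def by simp
qed

lemma self_adjoint_resolvent: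
  assumes G: "self_adjoint_op G" and z: "Im z \<noteq> 0"
  obtains R where "complex_linear R" "\<And>w. (blinfun_apply R w, w + z *\<^sub>C R w) \<in> G"
    "\<And>w g. (g, w + z *\<^sub>C g) \<in> G \<Longrightarrow> g = R w" "resolvent_op G z = graph_of R"
proof -
  note lin = self_adjoint_opD(1)[OF G]
  have "\<forall>w. \<exists>g. (g, w + z *\<^sub>C g) \<in> G" using self_adjoint_surj[OF G z] by blast
  from choice[OF this] obtain r where r: "\<And>w. (r w, w + z *\<^sub>C r w) \<in> G" by blast
  have uniq: "g = r w" if "(g, w + z *\<^sub>C g) \<in> G" for g w
  proof -
    have "(g - r w, 0 + z *\<^sub>C (g - r w)) \<in> G"
      using linear_opD(5)[OF lin that r[of w]] by (simp add: complex_vector.scale_right_diff_distrib)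
    from self_adjoint_norm_bound[OF G this] show ?thesis using z by (simp add: mult_le_0_iff)
  qed
  have add: "r (v + w) = r v + r w" for v w
  proof (rule uniq[symmetric])
    show "(r v + r w, v + w + z *\<^sub>C (r v + r w)) \<in> G"
      using linear_opD(3)[OF lin r[of v] r[of w]] by (simp add: scaleC_add_right algebra_simps)
  qed
  have sc: "r (c *\<^sub>C w) = c *\<^sub>C r w" for c w
  proof (rule uniq[symmetric])
    show "(c *\<^sub>C r w, c *\<^sub>C w + z *\<^sub>C c *\<^sub>C r w) \<in> G"
      using linear_opD(4)[OF lin r[of w], of c] by (simp add: scaleC_add_right mult.commute)
  qed
  have "bounded_linear r"
  proof (rule bounded_linear_intro[where K = "1 / \<bar>Im z\<bar>"])
    show "r (a *\<^sub>R w) = a *\<^sub>R r w" for a w using sc[of "complex_of_real a" w] by (simp add: scaleC_of_real)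
    show "norm (r w) \<le> norm w * (1 / \<bar>Im z\<bar>)" for w
      using self_adjoint_norm_bound[OF G r[of w]] z by (simp add: field_simps)
  qed (rule add)
  then have R: "blinfun_apply (Blinfun r) = r" by (rule bounded_linear_Blinfun_apply)
  show ?thesis
  proof (rule that[of "Blinfun r"], unfold R)
    show "complex_linear (Blinfun r)" by (simp add: complex_linear_def R sc)
    show "resolvent_op G z = graph_of (Blinfun r)"
      unfolding graph_of_def R using r uniq by (auto simp: resolvent_op_iff)
  qed (use r uniq in auto)
qed

lemma compact_op_compose:
  assumes K: "compact_op K" and N: "complex_linear N"
  shows "compact_op (K o\<^sub>L N)"
proof -
  have lin: "complex_linear K" using K by (simp add: compact_op_def)
  have "compact (closure (blinfun_apply K ` cball 0 1))" using K by (simp add: compact_op_def)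
  then have "compact ((*\<^sub>R) (norm N) ` closure (blinfun_apply K ` cball 0 1))"
    by (rule compact_scaling)
  moreover have "blinfun_apply (K o\<^sub>L N) ` cball 0 1 \<subseteq> (*\<^sub>R) (norm N) ` closure (blinfun_apply K ` cball 0 1)"
  proof
    fix y assume "y \<in> blinfun_apply (K o\<^sub>L N) ` cball 0 1"
    then obtain x where x: "norm x \<le> 1" "y = K (N x)" by auto
    have le: "norm (N x) \<le> norm N" 
      using norm_blinfun[of N x] mult_left_mono[OF x(1), of "norm N"] by simp
    show "y \<in> (*\<^sub>R) (norm N) ` closure (blinfun_apply K ` cball 0 1)"
    proof (cases "norm N = 0")
      case True
      then have "N = 0" by simp
      then have "y = norm N *\<^sub>R K 0" by (simp add: x(2) blinfun.zero_right)
      moreover have "K 0 \<in> closure (blinfun_apply K ` cball 0 1)"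
        by (rule subsetD[OF closure_subset], rule imageI) simp
      ultimately show ?thesis by blast
    next
      case False
      then have "y = norm N *\<^sub>R K ((1 / norm N) *\<^sub>R N x)" by (simp add: x(2) blinfun.scaleR_right)
      moreover have "K ((1 / norm N) *\<^sub>R N x) \<in> closure (blinfun_apply K ` cball 0 1)"
        by (rule subsetD[OF closure_subset], rule imageI) (use le False in \<open>simp add: divide_simps\<close>)
      ultimately show ?thesis by blast
    qed
  qed
  ultimately have "compact (closure (blinfun_apply (K o\<^sub>L N) ` cball 0 1))"
    by (metis closure_minimal closed_closure compact_imp_closed compact_Int_closed inf.absorb2)
  then show ?thesis using complex_linear_compose[OF lin N] by (simp add: compact_op_def)
qed

text \<open>Compactness is given at a single point \<open>z0\<close>. The resolvent identity R(z) =
  R(z0) (1 + (z - z0) R(z)) moves it to \<open>z\<close>, with the bracket as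
  \<open>N\<close>.\<close>

lemma relatively_compact_op_compact:
  assumes rc: "relatively_compact_op V G"
    and R: "complex_linear R" "\<And>w. (blinfun_apply R w, w + z *\<^sub>C R w) \<in> G"
  obtains B where "compact_op B" "\<And>w. (R w, blinfun_apply B w) \<in> V"
proof -
  from rc obtain z0 K where D: "Domain G \<subseteq> Domain V" and K: "compact_op K"
    and eq: "resolvent_op G z0 O V = graph_of K"
    unfolding relatively_compact_op_def by blast
  define N where "N = id_blinfun + (z - z0) *\<^sub>C R"
  have N: "N w = w + (z - z0) *\<^sub>C R w" for w
    by (simp add: N_def blinfun.add_left blinfun_apply_scaleC)
  have "complex_linear N"
    by (simp add: complex_linear_def N complex_linear_scaleC[OF R(1)] scaleC_add_right mult.commute)
  moreover have "(R w, K (N w)) \<in> V" for w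
  proof -
    have "N w + z0 *\<^sub>C R w = w + z *\<^sub>C R w"
      by (simp add: N complex_vector.scale_left_diff_distrib)
    then have "(N w, R w) \<in> resolvent_op G z0" using R(2)[of w] by (simp add: resolvent_op_iff)
    moreover obtain v where v: "(R w, v) \<in> V" using D R(2)[of w] by blast
    ultimately have "(N w, v) \<in> graph_of K" using eq by blast
    then show ?thesis using v by (simp add: graph_of_def)
  qed
  ultimately show ?thesis
    by (intro that[of "K o\<^sub>L N"] compact_op_compose[OF K]) simp_all
qed

section \<open>Independence of the rigging operator\<close>

lemma blinfun_eq_on_dense:
  fixes S T :: "'a::real_normed_vector \<Rightarrow>\<^sub>L 'b::real_normed_vector"
  assumes D: "closure D = UNIV" and eq: "\<And>x. x \<in> D \<Longrightarrow> S x = T x"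
  shows "S = T"
proof (rule blinfun_eqI)
  fix x
  have "x \<in> closure D" using D by simp
  then obtain f where f: "\<And>n. f n \<in> D" "f \<longlonglongrightarrow> x" unfolding closure_sequential by blast
  have "(\<lambda>n. S (f n)) \<longlonglongrightarrow> S x" "(\<lambda>n. T (f n)) \<longlonglongrightarrow> T x"
    by (intro blinfun.tendsto tendsto_const f)+
  then show "S x = T x" using eq[OF f(1)] LIMSEQ_unique by simp
qed

text \<open>Test \<open>x\<close> against elements of \<open>D\<close> that converge to
  \<open>x\<close> itself.\<close>

lemma norm_le_of_dense_cinner:
  fixes x :: "'a::complex_hilbert_space"
  assumes D: "closure D = UNIV" and C: "0 \<le> C" and le: "\<And>y. y \<in> D \<Longrightarrow> cmod (cinner x y) \<le> C * norm y"
  shows "norm x \<le> C"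
proof (cases "x = 0")
  case True
  with C show ?thesis by simp
next
  case False
  have "x \<in> closure D" using D by simp
  then obtain f where f: "\<And>n. f n \<in> D" "f \<longlonglongrightarrow> x" unfolding closure_sequential by blast
  have "(\<lambda>n. cmod (cinner (f n) x)) \<longlonglongrightarrow> cmod (cinner x x)"
    by (intro tendsto_norm bounded_linear.tendsto[OF bounded_linear_cinner_left] f)
  moreover have "(\<lambda>n. C * norm (f n)) \<longlonglongrightarrow> C * norm x" by (intro tendsto_intros f)
  moreover have "cmod (cinner (f n) x) \<le> C * norm (f n)" for n
    using le[OF f(1)[of n]] by (metis cinner_commute complex_mod_cnj)
  ultimately have "cmod (cinner x x) \<le> C * norm x" using LIMSEQ_le by blast
  then have "norm x * norm x \<le> C * norm x" by (simp add: cinner_self power2_eq_square norm_mult)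
  then show ?thesis using False by simp
qed

text \<open>This makes the definite description usable: \<open>F\<close> being closed, its adjoint
  is densely defined, and on that dense domain the value of any extension is forced.\<close>

lemma sandwiched_resolvent_extends:
  fixes F :: "('h::complex_hilbert_space, 'k::complex_hilbert_space) partial_op"
  assumes F: "linear_op F" "closed F" and D: "Domain G \<subseteq> Domain F"
    and R: "\<And>w. (blinfun_apply R w, w + z *\<^sub>C R w) \<in> G"
    and ex: "\<exists>T. extends_sandwich F G z T"
  shows "compact_op (sandwiched_resolvent F G z)"
    "(\<phi>, w) \<in> adjoint_op F \<Longrightarrow> (R w, k) \<in> F \<Longrightarrow> sandwiched_resolvent F G z \<phi> = k"
proof -
  have val: "T \<phi> = k" if T: "extends_sandwich F G z T" and "(\<phi>, w) \<in> adjoint_op F" "(R w, k) \<in> F" for T \<phi> w k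
  proof -
    have "(w, R w) \<in> resolvent_op G z" using R by (simp add: resolvent_op_iff)
    with that have "(\<phi>, k) \<in> graph_of T" unfolding extends_sandwich_def by blast
    then show ?thesis by (simp add: graph_of_def)
  qed
  have "T = T'" if "extends_sandwich F G z T" "extends_sandwich F G z T'" for T T'
  proof (rule blinfun_eq_on_dense[OF closure_Domain_adjoint_op[OF F]])
    fix \<phi> assume "\<phi> \<in> Domain (adjoint_op F)"
    then obtain w where w: "(\<phi>, w) \<in> adjoint_op F" by blast
    obtain k where "(R w, k) \<in> F" using R[of w] D by blast
    then show "T \<phi> = T' \<phi>" using val[OF that(1) w] val[OF that(2) w] by simp
  qed
  then have T: "extends_sandwich F G z (sandwiched_resolvent F G z)"
    unfolding sandwiched_resolvent_def using theI[of "extends_sandwich F G z"] ex by metis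
  then show "compact_op (sandwiched_resolvent F G z)" by (simp add: extends_sandwich_def)
  show "(\<phi>, w) \<in> adjoint_op F \<Longrightarrow> (R w, k) \<in> F \<Longrightarrow> sandwiched_resolvent F G z \<phi> = k"
    by (rule val[OF T])
qed

text \<open>For \<open>w = F\<^sup>* \<phi>\<close> the imaginary part of \<open>\<langle>T \<phi>, \<phi>\<rangle> = \<langle>R w, w\<rangle>\<close> is a multiple of \<open>\<parallel>R w\<parallel>\<^sup>2\<close>, so
  boundedness of \<open>T\<close> already yields boundedness of \<open>R F\<^sup>*\<close>.\<close>

lemma norm_resolvent_adjoint_le:
  assumes G: "self_adjoint_op G" and g: "(g, w + z *\<^sub>C g) \<in> G" and z: "Im z \<noteq> 0"
    and F: "(\<phi>, w) \<in> adjoint_op F" "(g, blinfun_apply T \<phi>) \<in> F"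
  shows "norm g \<le> sqrt (norm T / \<bar>Im z\<bar>) * norm \<phi>"
proof -
  have "cinner (T \<phi>) \<phi> = cinner g w" by (rule adjoint_opD[OF F])
  then have eq: "Im (cinner (T \<phi>) \<phi>) = Im z * (norm g)\<^sup>2"
    using self_adjoint_Im[OF G g] cinner_commute[of g w] by simp
  have "\<bar>Im z\<bar> * (norm g)\<^sup>2 \<le> cmod (cinner (T \<phi>) \<phi>)"
    using abs_Im_le_cmod[of "cinner (T \<phi>) \<phi>"] by (simp add: eq abs_mult)
  also have "\<dots> \<le> norm (T \<phi>) * norm \<phi>" by (rule norm_cinner_le)
  also have "\<dots> \<le> norm T * norm \<phi> * norm \<phi>" by (intro mult_right_mono norm_blinfun) auto
  finally have "(norm g)\<^sup>2 \<le> norm T / \<bar>Im z\<bar> * (norm \<phi>)\<^sup>2"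
    using z by (simp add: field_simps power2_eq_square)
  then have "sqrt ((norm g)\<^sup>2) \<le> sqrt (norm T / \<bar>Im z\<bar> * (norm \<phi>)\<^sup>2)" by (rule real_sqrt_le_mono)
  then show ?thesis unfolding real_sqrt_mult by simp
qed

text \<open>\<open>R\<close> and \<open>B\<close> are fixed without reference to \<open>F\<close>,
  so the right-hand sides are common to all rigging operators.\<close>

lemma rigging_poles_and_multiplicity:
  fixes H V :: "('h::complex_hilbert_space, 'h) partial_op"
    and F :: "('h, 'k::complex_hilbert_space) partial_op"
  assumes setting: "perturbation_setting H V D" and rigging: "admissible_rigging H V D F J"
    and z: "Im z \<noteq> 0"
    and R: "complex_linear R" "\<And>w. (blinfun_apply R w, w + z *\<^sub>C R w) \<in> perturb H V 0"
    and B: "compact_op B" "\<And>w. (R w, blinfun_apply B w) \<in> V"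
  shows "extension_poles (operator_A H V F J z) = singular_set B"
    "r \<noteq> 0 \<Longrightarrow> pole_multiplicity (operator_A H V F J z) r = algebraic_multiplicity B (1 / (0 - r))"
proof -
  let ?G = "perturb H V" and ?A = "operator_A H V F J z"
  have G: "self_adjoint_op (?G s)" "Domain (?G s) = D" for s
    using setting unfolding perturbation_setting_def operator_line_def by auto
  have DV: "D \<subseteq> Domain V" and V: "linear_op V"
    using setting unfolding perturbation_setting_def self_adjoint_op_def by auto
  have F: "linear_op F" "closed F" and F0: "\<And>x. (x, 0) \<in> F \<Longrightarrow> x = 0" and DF: "D \<subseteq> Domain F"
    and J: "self_adjoint_op (graph_of J)" and VF: "V = F O graph_of J O adjoint_op F"
    and ex: "\<And>s z. Im z \<noteq> 0 \<Longrightarrow> \<exists>T. extends_sandwich F (?G s) z T"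
    using rigging unfolding admissible_rigging_def operator_line_def by auto
  have linJ: "complex_linear J"
    using linear_opD(4)[OF self_adjoint_opD(1)[OF J]] by (simp add: graph_of_def complex_linear_def)
  have dense: "closure (Domain (adjoint_op F)) = UNIV" by (rule closure_Domain_adjoint_op[OF F])
  define T where "T s = sandwiched_resolvent F (?G s) z" for s
  have A_def: "?A s x = T s (J x)" for s x by (simp add: operator_A_def T_def)
  have uniqF: "k = k'" if "(g, k) \<in> F" "(g, k') \<in> F" for g k k' using linear_opD(1)[OF F(1) that] .
  have uniqV: "k = k'" if "(g, k) \<in> V" "(g, k') \<in> V" for g k k' using linear_opD(1)[OF V that] .

  have T0: "compact_op (T 0)"
      "\<And>\<phi> w k. (\<phi>, w) \<in> adjoint_op F \<Longrightarrow> (R w, k) \<in> F \<Longrightarrow> T 0 \<phi> = k"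
    using sandwiched_resolvent_extends[OF F _ R(2) ex[OF z]] G(2) DF unfolding T_def by blast+
  have compact_A0: "compact_op (?A 0)"
    unfolding operator_A_def using compact_op_compose[OF T0(1) linJ] by (simp add: T_def)
  have VD: "\<exists>k. (g, k) \<in> F \<and> (J k, v) \<in> adjoint_op F" if "(g, v) \<in> V" for g v
    using that unfolding VF graph_of_def by blast

  \<comment> \<open>The second resolvent identity in sandwiched form,
    \<open>T s (1 + s J T 0) = T 0\<close>. It is checked on the domain of the adjoint, where the
    values come from \<open>F\<close>, and extended by density.\<close>
  have resolvent_identity: "T s x + complex_of_real s *\<^sub>C T s (J (T 0 x)) = T 0 x" for s x
  proof -
    obtain Rs where Rs: "complex_linear Rs" "\<And>w. (blinfun_apply Rs w, w + z *\<^sub>C Rs w) \<in> ?G s"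
        "\<And>w g. (g, w + z *\<^sub>C g) \<in> ?G s \<Longrightarrow> g = Rs w" "resolvent_op (?G s) z = graph_of Rs"
      using self_adjoint_resolvent[OF G(1) z] by blast
    have Ts: "compact_op (T s)"
      "\<And>\<phi> w k. (\<phi>, w) \<in> adjoint_op F \<Longrightarrow> (Rs w, k) \<in> F \<Longrightarrow> T s \<phi> = k"
      using sandwiched_resolvent_extends[OF F _ Rs(2) ex[OF z]] G(2) DF unfolding T_def by blast+
    have "T s + complex_of_real s *\<^sub>C (T s o\<^sub>L (J o\<^sub>L T 0)) = T 0"
    proof (rule blinfun_eq_on_dense[OF dense])
      fix \<phi> assume "\<phi> \<in> Domain (adjoint_op F)"
      then obtain w where w: "(\<phi>, w) \<in> adjoint_op F" by blast
      obtain v where v: "(R w, v) \<in> V" using B(2) by blast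
      obtain k where k: "(R w, k) \<in> F" "(J k, v) \<in> adjoint_op F" using VD[OF v] by blast
      \<comment> \<open>\<open>H + s V\<close> sends \<open>R w\<close> to
        \<open>w + z R w + s v\<close>, so \<open>R w\<close> is also the perturbed resolvent
        applied to \<open>w + s v\<close>.\<close>
      have "(R w, (w + z *\<^sub>C R w) + s *\<^sub>R v) \<in> ?G s"
      proof -
        obtain u v' where "(R w, u) \<in> H" "w + z *\<^sub>C R w = u + 0 *\<^sub>R v'"
          using R(2)[of w] unfolding perturb_def by blast
        then show ?thesis using v unfolding perturb_def by auto
      qed
      then have "R w = Rs (w + complex_of_real s *\<^sub>C v)"
        by (intro Rs(3)) (simp add: scaleC_of_real algebra_simps)
      then have Rw: "Rs w = R w - complex_of_real s *\<^sub>C Rs v"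
        by (simp add: blinfun.add_right complex_linear_scaleC[OF Rs(1)])
      obtain k' where k': "(Rs v, k') \<in> F" using Rs(2)[of v] G(2) DF by blast
      have "(Rs w, k - complex_of_real s *\<^sub>C k') \<in> F"
        unfolding Rw by (intro linear_opD(5)[OF F(1)] linear_opD(4)[OF F(1)] k k')
      then have "T s \<phi> = k - complex_of_real s *\<^sub>C k'" by (rule Ts(2)[OF w])
      moreover have "T 0 \<phi> = k" by (rule T0(2)[OF w k(1)])
      moreover have "T s (J k) = k'" by (rule Ts(2)[OF k(2) k'])
      ultimately show "(T s + complex_of_real s *\<^sub>C (T s o\<^sub>L (J o\<^sub>L T 0))) \<phi> = T 0 \<phi>"
        by (simp add: blinfun.add_left blinfun_apply_scaleC)
    qed
    then have "(T s + complex_of_real s *\<^sub>C (T s o\<^sub>L (J o\<^sub>L T 0))) x = T 0 x" by simp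
    then show ?thesis by (simp add: blinfun.add_left blinfun_apply_scaleC)
  qed

  have poles: "extension_poles ?A = singular_set (?A 0)"
  proof (rule extension_poles_eq_singular_set[where A = ?A, OF compact_A0])
    fix s x
    obtain Rs where Rs: "complex_linear Rs" "\<And>w. (blinfun_apply Rs w, w + z *\<^sub>C Rs w) \<in> ?G s"
        "\<And>w g. (g, w + z *\<^sub>C g) \<in> ?G s \<Longrightarrow> g = Rs w" "resolvent_op (?G s) z = graph_of Rs"
      using self_adjoint_resolvent[OF G(1) z] by blast
    have "compact_op (T s)"
      using sandwiched_resolvent_extends(1)[OF F _ Rs(2) ex[OF z]] G(2) DF unfolding T_def by blast
    then have "complex_linear (T s)" by (simp add: compact_op_def)
    \<comment> \<open>The sandwiched identity at \<open>J x\<close> is the same relation for the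
      products \<open>T s J\<close>.\<close>
    then show "?A s (x + complex_of_real s *\<^sub>C ?A 0 x) = ?A 0 x"
      using resolvent_identity[of s "J x"]
      by (simp add: A_def blinfun.add_right complex_linear_scaleC[OF linJ] complex_linear_scaleC)
  qed

  have "\<forall>h. \<exists>k. (R h, k) \<in> F" using R(2) G(2)[of 0] DF by blast
  from choice[OF this] obtain X where X: "\<And>h. (R h, X h) \<in> F" by blast
  have X_add: "X (a + b) = X a + X b" for a b
    using uniqF[OF X[of "a + b"]] linear_opD(3)[OF F(1) X[of a] X[of b]] by (simp add: blinfun.add_right)
  have X_sc: "X (c *\<^sub>C a) = c *\<^sub>C X a" for c a
    using uniqF[OF X[of "c *\<^sub>C a"]] linear_opD(4)[OF F(1) X[of a], of c] by (simp add: complex_linear_scaleC[OF R(1)])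
  \<comment> \<open>Boundedness of \<open>X\<close> by duality: the product of \<open>X h\<close>
    with \<phi> is that of \<open>h\<close> with \<open>R' w\<close>, where \<open>R'\<close> is the
    adjoint of \<open>R\<close>, the resolvent at \<open>cnj z\<close>. The constant
    \<open>C\<close> is the one of \<open>norm_resolvent_adjoint_le\<close> at
    \<open>cnj z\<close>.\<close>
  have z': "Im (cnj z) \<noteq> 0" using z by simp
  obtain R' where R': "complex_linear R'" "\<And>w. (blinfun_apply R' w, w + cnj z *\<^sub>C R' w) \<in> ?G 0"
        "\<And>w g. (g, w + cnj z *\<^sub>C g) \<in> ?G 0 \<Longrightarrow> g = R' w" "resolvent_op (?G 0) (cnj z) = graph_of R'"
      using self_adjoint_resolvent[OF G(1) z'] by blast
  define T' where "T' = sandwiched_resolvent F (?G 0) (cnj z)"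
  have T': "T' \<phi> = k" if "(\<phi>, w) \<in> adjoint_op F" "(R' w, k) \<in> F" for \<phi> w k
    using sandwiched_resolvent_extends(2)[OF F _ R'(2) ex[OF z'] that] G(2) DF unfolding T'_def by blast
  define C where "C = sqrt (norm T' / \<bar>Im (cnj z)\<bar>)"
  have X_bound: "norm (X h) \<le> norm h * C" for h
  proof (rule norm_le_of_dense_cinner[OF dense])
    show "0 \<le> norm h * C" by (simp add: C_def)
  next
    fix \<phi> assume "\<phi> \<in> Domain (adjoint_op F)"
    then obtain w where w: "(\<phi>, w) \<in> adjoint_op F" by blast
    obtain k where k: "(R' w, k) \<in> F" using R'(2) G(2)[of 0] DF by blast
    have "cinner (X h) \<phi> = cinner (R h) w" by (rule adjoint_opD[OF w X])
    also have "\<dots> = cinner h (R' w)"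
    proof -
      have "cinner (h + z *\<^sub>C R h) (R' w) = cinner (R h) (w + cnj z *\<^sub>C R' w)"
        by (rule self_adjoint_opD(2)[OF G(1) R(2) R'(2)])
      then show ?thesis by (simp add: cinner_add_left cinner_add_right cinner_scaleC_left cinner_scaleC_right)
    qed
    finally have "cmod (cinner (X h) \<phi>) \<le> norm h * norm (R' w)" by (simp add: norm_cinner_le)
    also have "norm (R' w) \<le> C * norm \<phi>"
      unfolding C_def using norm_resolvent_adjoint_le[OF G(1) R'(2) z' w] k T'[OF w k] by simp
    then have "norm h * norm (R' w) \<le> norm h * (C * norm \<phi>)" by (rule mult_left_mono) simp
    finally show "cmod (cinner (X h) \<phi>) \<le> norm h * C * norm \<phi>" by (simp add: mult.assoc)
  qed
  have "bounded_linear X"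
    by (rule bounded_linear_intro[where K = C])
       (use X_add X_bound X_sc[of "complex_of_real _"] in \<open>auto simp: scaleC_of_real\<close>)
  then have Xb: "blinfun_apply (Blinfun X) = X" by (rule bounded_linear_Blinfun_apply)
  have linX: "complex_linear (Blinfun X)" by (simp add: complex_linear_def Xb X_sc)
  have injX: "h = 0" if "Blinfun X h = 0" for h
  proof -
    have "R h = 0" using F0 X[of h] that by (simp add: Xb)
    then have "(0, h) \<in> ?G 0" using R(2)[of h] by simp
    then show ?thesis using linear_opD(1,2)[OF self_adjoint_opD(1)[OF G(1)]] by blast
  qed
  \<comment> \<open>With F' for the adjoint of \<open>F\<close>, both sides are F R F' J F R h, read
    once as (F R) (V R) h and once as (F R F') J (F R) h.\<close>
  have inter: "Blinfun X (B h) = ?A 0 (Blinfun X h)" for h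
  proof -
    obtain k where k: "(R h, k) \<in> F" "(J k, B h) \<in> adjoint_op F" using VD[OF B(2)] by blast
    then have "k = X h" using uniqF X by blast
    then show ?thesis using T0(2)[OF k(2) X] by (simp add: Xb A_def)
  qed
  \<comment> \<open>\<open>T 0\<close> maps the domain of the adjoint into the range of
    \<open>X\<close>, because there \<open>T 0 \<phi> = F (R w) = X w\<close>. The vector
    \<open>J k\<close> is only a limit of such \<phi>, hence the closure.\<close>
  have ran: "?A 0 k \<in> closure (range (blinfun_apply (Blinfun X)))" for k
  proof -
    have "J k \<in> closure (Domain (adjoint_op F))" using dense by simp
    then obtain f where f: "\<And>n. f n \<in> Domain (adjoint_op F)" "f \<longlonglongrightarrow> J k"
      unfolding closure_sequential by blast
    have "T 0 (f n) \<in> range X" for n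
    proof -
      obtain w where "(f n, w) \<in> adjoint_op F" using f(1) by blast
      then show ?thesis using T0(2)[OF _ X] by blast
    qed
    moreover have "(\<lambda>n. T 0 (f n)) \<longlonglongrightarrow> ?A 0 k"
      unfolding A_def by (intro blinfun.tendsto tendsto_const f)
    ultimately show ?thesis unfolding Xb by (rule closure_limitI)
  qed
  have E: "Blinfun X ` generalized_eigenspace B \<mu> = generalized_eigenspace (?A 0) \<mu>" if "\<mu> \<noteq> 0" for \<mu>
    by (rule generalized_eigenspace_transfer[OF B(1) compact_A0 linX injX inter ran that])
  show "extension_poles ?A = singular_set B"
  proof (rule set_eqI)
    fix s
    have lin: "complex_linear B" "complex_linear (?A 0)" using B(1) compact_A0 by (simp_all add: compact_op_def)
    show "s \<in> extension_poles ?A \<longleftrightarrow> s \<in> singular_set B"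
    proof (cases "s = 0")
      case False
      then have "(\<exists>x\<in>generalized_eigenspace (?A 0) (- 1 / s). x \<noteq> 0) \<longleftrightarrow> (\<exists>x\<in>generalized_eigenspace B (- 1 / s). x \<noteq> 0)"
      proof -
        have "(\<exists>x\<in>generalized_eigenspace (?A 0) (- 1 / s). x \<noteq> 0) \<longleftrightarrow>
            (\<exists>x\<in>Blinfun X ` generalized_eigenspace B (- 1 / s). x \<noteq> 0)"
          using E[of "- 1 / s"] False by simp
        also have "\<dots> \<longleftrightarrow> (\<exists>x\<in>generalized_eigenspace B (- 1 / s). Blinfun X x \<noteq> 0)" by blast
        also have "\<dots> \<longleftrightarrow> (\<exists>x\<in>generalized_eigenspace B (- 1 / s). x \<noteq> 0)"
          using injX by (metis blinfun.zero_right)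
        finally show ?thesis .
      qed
      then show ?thesis
        unfolding poles singular_set_iff_generalized_eigenspace[OF lin(1)]
          singular_set_iff_generalized_eigenspace[OF lin(2)] by blast
    qed (simp add: poles singular_set_def)
  qed
  \<comment> \<open>At \<open>r = 0\<close> the HOL value of \<open>1 / (0 - r)\<close> is 0, an
    eigenvalue to which the transfer \<open>E\<close> does not apply.\<close>
  assume r: "r \<noteq> 0"
  show "pole_multiplicity ?A r = algebraic_multiplicity B (1 / (0 - r))"
    using complex_dim_injective_image[OF linX injX, of "generalized_eigenspace B (1 / (0 - r))"] E[of "1 / (0 - r)"] r
    unfolding pole_multiplicity_def algebraic_multiplicity_def generalized_eigenspace_def by simp
qed

text \<open>The two sums agree for every \<open>y > 0\<close> and every radius, before any limit is
  taken. The two definite descriptions therefore concern the same predicate, and their values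
  coincide.\<close>

lemma split_pole_count_independent:
  fixes H V :: "('h::complex_hilbert_space, 'h) partial_op"
    and F1 :: "('h, 'k1::complex_hilbert_space) partial_op"
    and F2 :: "('h, 'k2::complex_hilbert_space) partial_op"
  assumes setting: "perturbation_setting H V D"
    and F1: "admissible_rigging H V D F1 J1" and F2: "admissible_rigging H V D F2 J2"
  shows "split_pole_count H V F1 J1 lam U = split_pole_count H V F2 J2 lam U"
proof -
  have eq: "(\<Sum>r \<in> extension_poles (operator_A H V F1 J1 (Complex lam y)) \<inter> U \<inter> ball 0 \<epsilon>.
           pole_multiplicity (operator_A H V F1 J1 (Complex lam y)) r) =
         (\<Sum>r \<in> extension_poles (operator_A H V F2 J2 (Complex lam y)) \<inter> U \<inter> ball 0 \<epsilon>.
           pole_multiplicity (operator_A H V F2 J2 (Complex lam y)) r)" if y: "y > 0" for y \<epsilon>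
  proof -
    have z: "Im (Complex lam y) \<noteq> 0" using y by simp
    have G: "self_adjoint_op (perturb H V 0)" "relatively_compact_op V (perturb H V 0)"
      using setting unfolding perturbation_setting_def operator_line_def by auto
    obtain R where R: "complex_linear R" "\<And>w. (blinfun_apply R w, w + Complex lam y *\<^sub>C R w) \<in> perturb H V 0"
        "\<And>w g. (g, w + Complex lam y *\<^sub>C g) \<in> perturb H V 0 \<Longrightarrow> g = R w" "resolvent_op (perturb H V 0) (Complex lam y) = graph_of R"
      using self_adjoint_resolvent[OF G(1) z] by blast
    obtain B where B: "compact_op B" "\<And>w. (R w, blinfun_apply B w) \<in> V"
      using relatively_compact_op_compact[OF G(2) R(1,2)] by blast
    \<comment> \<open>No pole sits at 0, so the multiplicity formula applies to every
      summand.\<close>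
    have "r \<noteq> 0" if "r \<in> singular_set B" for r using that by (auto simp: singular_set_def)
    then show ?thesis
      unfolding rigging_poles_and_multiplicity(1)[OF setting F1 z R(1,2) B] rigging_poles_and_multiplicity(1)[OF setting F2 z R(1,2) B]
      by (intro sum.cong refl)
         (simp add: rigging_poles_and_multiplicity(2)[OF setting F1 z R(1,2) B] rigging_poles_and_multiplicity(2)[OF setting F2 z R(1,2) B])
  qed
  have "(\<forall>\<^sub>F y in at_right 0.
           (\<Sum>r \<in> extension_poles (operator_A H V F1 J1 (Complex lam y)) \<inter> U \<inter> ball 0 \<epsilon>.
              pole_multiplicity (operator_A H V F1 J1 (Complex lam y)) r) = n) =
        (\<forall>\<^sub>F y in at_right 0.
           (\<Sum>r \<in> extension_poles (operator_A H V F2 J2 (Complex lam y)) \<inter> U \<inter> ball 0 \<epsilon>.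
              pole_multiplicity (operator_A H V F2 J2 (Complex lam y)) r) = n)" for \<epsilon> n
    by (rule eventually_subst, rule eventually_mono[OF eventually_at_right_less[of 0]]) (simp only: eq)
  then show ?thesis
    unfolding split_pole_count_def by (simp only:)
qed

theorem theorem1p37:
  fixes H V :: "('h::complex_hilbert_space, 'h) partial_op"
    and D :: "'h set"
    and F1 :: "('h, 'k1::complex_hilbert_space) partial_op"
    and F2 :: "('h, 'k2::complex_hilbert_space) partial_op"
    and J1 :: "'k1 \<Rightarrow>\<^sub>L 'k1" and J2 :: "'k2 \<Rightarrow>\<^sub>L 'k2"
    and lam :: real
  assumes "separable_space (euclidean :: 'h topology)"
    and "separable_space (euclidean :: 'k1 topology)"
    and "separable_space (euclidean :: 'k2 topology)"
    and "perturbation_setting H V D"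
    and "admissible_rigging H V D F1 J1"
    and "admissible_rigging H V D F2 J2"
    and "essentially_regular lam (operator_line H V) F1"
    and "essentially_regular lam (operator_line H V) F2"
    and "resonant_at H F1 lam"
    and "resonant_at H F2 lam"
    and "regularizing_direction V H F1 lam"
    and "regularizing_direction V H F2 lam"
  shows "resonance_index H V F1 J1 lam = resonance_index H V F2 J2 lam"
  unfolding resonance_index_def
  using split_pole_count_independent[OF assms(4-6)] by simp

end
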